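(* Let $n\ge 1$ and let $K:\mathbb{R}^n\to[0,\infty]$ be an integrable kernel that is nonnegative, radial ($|x|=|y|$ implies $K(x)=K(y)$), decreasing ($|x|\le |y|$ implies $K(x)\ge K(y)$), and unbounded with $K(0)=\infty$ (that is, $K(x)\to\infty$ as $x\to 0$). Let $L^1_K(\mathbb{R}^n)$, $r_K$, $M_\Omega$ and $\widehat{\Omega}_K$ be as defined in the context. Then there exists a region $\Omega\subset\mathbb{R}^{n+1}_+$ with the following properties: (i) $\Omega$ satisfies the cone condition: for every $(x,t)\in\Omega$, $\{(y,s)\in\mathbb{R}^{n+1}_+:|x-y|\le s-t\}\subset\Omega$. (ii) There is a constant $C<\infty$ such that $|\Omega(t)|\le C\,(r_K(t))^n$ for all $t>0$. (iii) There is a constant $C<\infty$ such that, for all $f\in L^1_K(\mathbb{R}^n)$ and all $\lambda>0$, $$|\{x\in\mathbb{R}^n: M_\Omega f(x)>\lambda\}|\le C\,\frac{\|f\|_{L^1_K(\mathbb{R}^n)}}{\lambda}.$$ (iv) The function $t\mapsto \dfrac{|\widehat{\Omega}_K(t)|}{(r_K(t))^n}$ is unbounded on $(0,\infty)$. (v) $M_{\widehat{\Omega}_K}$ is not of weak type $(1,1)$ on the potential space, i.e. there is no constant $C<\infty$ such that $|\{x\in\mathbb{R}^n:M_{\widehat{\Omega}_K}f(x)>\lambda\}|\le C\|f\|_{L^1_K(\mathbb{R}^n)}/\lambda$ for all $f\in L^1_K(\mathbb{R}^n)$ and all $\lambda>0$.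
   Context: Notation: $\mathbb{R}^{n+1}_+=\{(x,t):x\in\mathbb{R}^n,\ t>0\}$; $|E|$ is the Lebesgue measure of $E\subset\mathbb{R}^n$. $P_t(x)=c_n\,t\,(t^2+|x|^2)^{-(n+1)/2}$ is the Poisson kernel in $\mathbb{R}^{n+1}_+$, with $c_n$ chosen so that $\int_{\mathbb{R}^n}P_t=1$; $*$ denotes convolution on $\mathbb{R}^n$. Potential space: $L^1_K(\mathbb{R}^n)=\{f: f=K*F,\ F\in L^1(\mathbb{R}^n)\}$, with norm $\|f\|_{L^1_K(\mathbb{R}^n)}=\inf\{\|F\|_{L^1(\mathbb{R}^n)}: f=K*F\}$. Maximal function: for $\Omega\subset\mathbb{R}^{n+1}_+$, let $\Omega_x=x+\Omega=\{(x+y,t):(y,t)\in\Omega\}$ and $$M_\Omega f(x)=\sup_{(y,t)\in\Omega_x}|P_t*f(y)|.$$ Cross-sections: $\Omega(t)=\{x\in\mathbb{R}^n:(x,t)\in\Omega\}$ for $t>0$. The function $r_K$: $r_K(t)=\|P_t*K\|_\infty^{-1/n}$ for $t>0$. Completed region: for $\Omega\subset\mathbb{R}^{n+1}_+$, $$\widehat{\Omega}_K=\{(y,t)\in\mathbb{R}^{n+1}_+:\ \exists (x,s)\in\Omega,\ |x-y|\le r_K(t)-r_K(s)\}.$$ *)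

theory Defs
  imports "HOL-Analysis.Analysis" "HOL-Probability.Essential_Supremum"
begin

text \<open>
  The space \<open>\<real>\<^sup>n\<close> is \<open>real ^ 'n\<close> with \<open>n = CARD('n) \<ge> 1\<close>. All measures and integrals are taken with
  respect to the completed measure \<open>lebesgue\<close>, so that measurability and integrability do not
  depend on the representative chosen in an almost-everywhere class.
\<close>

definition half_space :: "((real ^ 'n::finite) \<times> real) set" where
  "half_space = {(x, t). t > 0}"

definition conv :: "(real ^ 'n::finite \<Rightarrow> real) \<Rightarrow> (real ^ 'n \<Rightarrow> real) \<Rightarrow> real ^ 'n \<Rightarrow> real" where
  "conv g h x = (\<integral>y. g (x - y) * h y \<partial>lebesgue)"

text \<open>
  The constant \<open>c\<^sub>n\<close> is fixed by normalising the kernel at \<open>t = 1\<close>; the substitution \<open>x = t u\<close> shows that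
  the integral of \<open>t (t\<^sup>2 + |x|\<^sup>2) powr (-(n+1)/2)\<close> does not depend on \<open>t > 0\<close>.
\<close>

definition poisson_const :: "'n::finite itself \<Rightarrow> real" where
  "poisson_const _ =
     1 / (\<integral>x. (1 + (norm (x :: real ^ 'n))\<^sup>2) powr (- (real CARD('n) + 1) / 2) \<partial>lebesgue)"

definition poisson :: "real \<Rightarrow> real ^ 'n::finite \<Rightarrow> real" where
  "poisson t x = poisson_const TYPE('n) * t
     * (t\<^sup>2 + (norm x)\<^sup>2) powr (- (real CARD('n) + 1) / 2)"

text \<open>
  Kernels take values in \<open>[0,\<infinity>]\<close>. Inside a convolution they are converted by \<open>enn2real\<close>, which
  maps \<open>\<infinity>\<close> to \<open>0\<close>; an integrable kernel is finite almost everywhere, so this changes no integral.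
\<close>

definition kconv :: "(real ^ 'n::finite \<Rightarrow> ennreal) \<Rightarrow> (real ^ 'n \<Rightarrow> real) \<Rightarrow> real ^ 'n \<Rightarrow> real" where
  "kconv K F = conv (\<lambda>x. enn2real (K x)) F"

text \<open>
  \<open>f = K * F\<close> is an identity of \<open>L\<^sup>1\<close> functions and hence is required almost everywhere (the
  convolution integral itself converges only for almost every point).
\<close>

definition represents ::
  "(real ^ 'n::finite \<Rightarrow> ennreal) \<Rightarrow> (real ^ 'n \<Rightarrow> real) \<Rightarrow> (real ^ 'n \<Rightarrow> real) \<Rightarrow> bool" where
  "represents K F f \<longleftrightarrow> integrable lebesgue F \<and> (AE x in lebesgue. f x = kconv K F x)"

definition potential_space :: "(real ^ 'n::finite \<Rightarrow> ennreal) \<Rightarrow> (real ^ 'n \<Rightarrow> real) set" where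
  "potential_space K = {f. \<exists>F. represents K F f}"

definition potential_norm :: "(real ^ 'n::finite \<Rightarrow> ennreal) \<Rightarrow> (real ^ 'n \<Rightarrow> real) \<Rightarrow> real" where
  "potential_norm K f = Inf {(\<integral>x. \<bar>F x\<bar> \<partial>lebesgue) | F. represents K F f}"

definition shift_region ::
  "real ^ 'n::finite \<Rightarrow> ((real ^ 'n) \<times> real) set \<Rightarrow> ((real ^ 'n) \<times> real) set" where
  "shift_region x \<Omega> = {(x + y, t) | y t. (y, t) \<in> \<Omega>}"

definition maximal_fun ::
  "((real ^ 'n::finite) \<times> real) set \<Rightarrow> (real ^ 'n \<Rightarrow> real) \<Rightarrow> real ^ 'n \<Rightarrow> ennreal" where
  "maximal_fun \<Omega> f x = (SUP (y, t) \<in> shift_region x \<Omega>. ennreal \<bar>conv (poisson t) f y\<bar>)"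

definition cross_section :: "((real ^ 'n::finite) \<times> real) set \<Rightarrow> real \<Rightarrow> (real ^ 'n) set" where
  "cross_section \<Omega> t = {x. (x, t) \<in> \<Omega>}"

definition rK :: "(real ^ 'n::finite \<Rightarrow> ennreal) \<Rightarrow> real \<Rightarrow> real" where
  "rK K t = enn2real (esssup lebesgue
       (\<lambda>x. ennreal \<bar>conv (poisson t) (\<lambda>y. enn2real (K y)) x\<bar>)) powr (- 1 / real CARD('n))"

definition completed_region ::
  "(real ^ 'n::finite \<Rightarrow> ennreal) \<Rightarrow> ((real ^ 'n) \<times> real) set \<Rightarrow> ((real ^ 'n) \<times> real) set" where
  "completed_region K \<Omega> =
     {(y, t). (y, t) \<in> half_space \<and> (\<exists>(x, s) \<in> \<Omega>. norm (x - y) \<le> rK K t - rK K s)}"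

definition cone_condition :: "((real ^ 'n::finite) \<times> real) set \<Rightarrow> bool" where
  "cone_condition \<Omega> \<longleftrightarrow>
     (\<forall>(x, t) \<in> \<Omega>. {(y, s). (y, s) \<in> half_space \<and> norm (x - y) \<le> s - t} \<subseteq> \<Omega>)"

text \<open>
  The superlevel sets below are open, since the maximal function is a supremum of
  continuous functions; no separate measurability requirement is needed.
\<close>

definition weak_type_11 ::
  "(real ^ 'n::finite \<Rightarrow> ennreal) \<Rightarrow> ((real ^ 'n) \<times> real) set \<Rightarrow> bool" where
  "weak_type_11 K \<Omega> \<longleftrightarrow>
     (\<exists>C::real. \<forall>f \<in> potential_space K. \<forall>\<alpha>>0.
        emeasure lebesgue {x. maximal_fun \<Omega> f x > ennreal \<alpha>}
          \<le> ennreal (C * potential_norm K f / \<alpha>))"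

end

theory Submission
  imports Defs
begin

text \<open>
  Write \<open>n = CARD('n)\<close>. Up to constants \<open>r\<^sub>K(t) ^ n\<close> is \<open>1 / (P\<^sub>t * K)(0)\<close>. Since \<open>K\<close> is unbounded
  at the origin, \<open>r\<^sub>K(t) \<rightarrow> 0\<close> as \<open>t \<rightarrow> 0\<close>; since \<open>K\<close> is integrable, \<open>t ^ n * (P\<^sub>t * K)(0) \<rightarrow> 0\<close>, that is,
  \<open>t = o(r\<^sub>K(t))\<close>. Near the boundary there is thus much room between the volume \<open>t ^ n\<close> of a section of a
  cone and the volume \<open>r\<^sub>K(t) ^ n\<close> of the balls that the completion attaches to each point.

  The region \<open>\<Omega>\<close> is the cone at the origin together with, for each \<open>k\<close>, \<open>k\<close> cones with distinct vertices
  at distance at most \<open>\<delta> k\<close> from the origin and at a tiny height \<open>\<tau> k\<close>. Above height \<open>\<delta> k\<close> the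
  \<open>k\<close>-th group is swallowed by a cone of aperture \<open>2\<close> at the origin. Below, it
  contributes at most \<open>k * t ^ n\<close> to the section, which for small \<open>\<delta> k\<close> is at most
  \<open>2 ^ (- k) * r\<^sub>K(t) ^ n\<close>; summation gives the volume bound (\<open>emeasure_cross_section_region\<close>).

  In the completion each vertex carries a ball of radius at least \<open>r\<^sub>K(t) / 2\<close> at height \<open>t\<close>, if \<open>\<tau> k\<close> is
  so small that \<open>r\<^sub>K(2 * \<tau> k) \<le> r\<^sub>K(t) / 2\<close>. At a height \<open>T k\<close> with \<open>r\<^sub>K(T k)\<close> below the spacing of the vertices, these \<open>k\<close> balls are
  disjoint and the section has volume at least a constant times \<open>k * r\<^sub>K(T k) ^ n\<close>
  (\<open>emeasure_cross_section_completed\<close>). The potential of the ball of radius \<open>T k\<close> behaves at height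
  \<open>T k\<close> like the potential of a point mass, for which the maximal function exceeds a multiple of
  \<open>r\<^sub>K(T k) ^ (- n)\<close> on the reflected section; so the weak type inequality fails too.

  The weak type inequality for \<open>\<Omega>\<close> itself (\<open>region_superlevel_measure\<close>) comes from splitting \<open>K\<close> at
  \<open>|x| = \<delta> k\<close> when dealing with the \<open>k\<close>-th group. The far part of \<open>K\<close>, translated by a vertex, is
  dominated by the dilate \<open>K (x / 2)\<close>, so that its contribution is controlled by one nontangential
  maximal function for all groups at once. The near part has \<open>L\<^sup>1\<close> norm at most \<open>2 ^ (- k) / k\<close> if
  \<open>\<delta> k\<close> is small, so that the weak type bounds for its \<open>k\<close> translates can be added and
  summed over \<open>k\<close>. The nontangential weak type inequality on \<open>L\<^sup>1\<close> is the Hardy--Littlewood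
  theorem (\<open>nt_superlevel_weak_type\<close>).

  All estimates are carried out for convolutions of Borel functions with values in \<open>[0, \<infinity>]\<close>, for
  which Tonelli's theorem applies unconditionally; real-valued convolutions are compared with these at
  the beginning and at the end.
\<close>

section \<open>Convolutions of nonnegative functions\<close>

definition econv :: "('a::euclidean_space \<Rightarrow> ennreal) \<Rightarrow> ('a \<Rightarrow> ennreal) \<Rightarrow> 'a \<Rightarrow> ennreal" where
  "econv g h x = (\<integral>\<^sup>+y. g (x - y) * h y \<partial>lborel)"

lemma cball_in_borel [measurable]: "cball (c :: 'a::euclidean_space) r \<in> sets borel"
  by simp

lemma nn_integral_lborel_affine:
  fixes f :: "'a::euclidean_space \<Rightarrow> ennreal" and v :: 'a
  assumes [measurable]: "f \<in> borel_measurable borel" and c: "c \<noteq> 0"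
  shows "(\<integral>\<^sup>+x. f x \<partial>lborel) = ennreal (\<bar>c\<bar> ^ DIM('a)) * (\<integral>\<^sup>+x. f (v + c *\<^sub>R x) \<partial>lborel)"
  by (subst lborel_affine[OF c, of v])
     (simp add: nn_integral_density nn_integral_distr nn_integral_cmult)

lemma nn_integral_lborel_translate:
  fixes f :: "'a::euclidean_space \<Rightarrow> ennreal"
  assumes "f \<in> borel_measurable borel"
  shows "(\<integral>\<^sup>+x. f (x + v) \<partial>lborel) = (\<integral>\<^sup>+x. f x \<partial>lborel)"
  using nn_integral_lborel_affine[OF assms, of 1 v] by (simp add: add.commute)

lemma emeasure_translate:
  fixes A :: "'a::euclidean_space set"
  assumes [measurable]: "A \<in> sets borel"
  shows "emeasure lborel {x. x + v \<in> A} = emeasure lborel A"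
proof -
  have [measurable]: "{x. x + v \<in> A} \<in> sets borel" by measurable
  have "emeasure lborel {x. x + v \<in> A} = (\<integral>\<^sup>+x. indicator {x. x + v \<in> A} x \<partial>lborel)"
    by simp
  also have "\<dots> = (\<integral>\<^sup>+x. indicator A (x + v) \<partial>lborel)"
    by (rule nn_integral_cong) (simp add: indicator_def)
  also have "\<dots> = emeasure lborel A"
    by (subst nn_integral_lborel_translate) auto
  finally show ?thesis .
qed

lemma nn_integral_lborel_reflect:
  fixes f :: "'a::euclidean_space \<Rightarrow> ennreal"
  assumes "f \<in> borel_measurable borel"
  shows "(\<integral>\<^sup>+x. f (v - x) \<partial>lborel) = (\<integral>\<^sup>+x. f x \<partial>lborel)"
  using nn_integral_lborel_affine[OF assms, of "-1" v] by simp

lemma borel_measurable_econv [measurable]: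
  fixes g h :: "'a::euclidean_space \<Rightarrow> ennreal"
  assumes [measurable]: "g \<in> borel_measurable borel" "h \<in> borel_measurable borel"
  shows "econv g h \<in> borel_measurable borel"
proof -
  have "(\<lambda>x. \<integral>\<^sup>+y. g (x - y) * h y \<partial>lborel) \<in> borel_measurable borel"
    by measurable
  then show ?thesis by (simp add: econv_def[abs_def])
qed

lemma nn_integral_econv:
  fixes g h :: "'a::euclidean_space \<Rightarrow> ennreal"
  assumes [measurable]: "g \<in> borel_measurable borel" "h \<in> borel_measurable borel"
  shows "(\<integral>\<^sup>+x. econv g h x \<partial>lborel) = (\<integral>\<^sup>+x. g x \<partial>lborel) * (\<integral>\<^sup>+x. h x \<partial>lborel)"
proof -
  have "(\<integral>\<^sup>+x. econv g h x \<partial>lborel) = (\<integral>\<^sup>+y. (\<integral>\<^sup>+x. g (x - y) * h y \<partial>lborel) \<partial>lborel)"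
    unfolding econv_def by (rule lborel_pair.Fubini') measurable
  also have "\<dots> = (\<integral>\<^sup>+y. (\<integral>\<^sup>+x. g x \<partial>lborel) * h y \<partial>lborel)"
  proof (rule nn_integral_cong)
    fix y :: 'a
    have "(\<integral>\<^sup>+x. g (x - y) * h y \<partial>lborel) = (\<integral>\<^sup>+x. g (x - y) \<partial>lborel) * h y"
      by (rule nn_integral_multc) measurable
    also have "(\<integral>\<^sup>+x. g (x - y) \<partial>lborel) = (\<integral>\<^sup>+x. g x \<partial>lborel)"
      using nn_integral_lborel_translate[of g "-y"] by simp
    finally show "(\<integral>\<^sup>+x. g (x - y) * h y \<partial>lborel) = (\<integral>\<^sup>+x. g x \<partial>lborel) * h y" .
  qed
  also have "\<dots> = (\<integral>\<^sup>+x. g x \<partial>lborel) * (\<integral>\<^sup>+x. h x \<partial>lborel)"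
    by (rule nn_integral_cmult) measurable
  finally show ?thesis .
qed

lemma econv_assoc:
  fixes f g h :: "'a::euclidean_space \<Rightarrow> ennreal"
  assumes [measurable]: "f \<in> borel_measurable borel" "g \<in> borel_measurable borel"
    "h \<in> borel_measurable borel"
  shows "econv f (econv g h) x = econv (econv f g) h x"
proof -
  have "econv f (econv g h) x = (\<integral>\<^sup>+y. (\<integral>\<^sup>+z. f (x - y) * (g (y - z) * h z) \<partial>lborel) \<partial>lborel)"
    unfolding econv_def by (simp add: nn_integral_cmult)
  also have "\<dots> = (\<integral>\<^sup>+z. (\<integral>\<^sup>+y. f (x - y) * (g (y - z) * h z) \<partial>lborel) \<partial>lborel)"
    by (rule lborel_pair.Fubini') measurable
  also have "\<dots> = econv (econv f g) h x"
    unfolding econv_def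
  proof (rule nn_integral_cong)
    fix z :: 'a
    have "(\<integral>\<^sup>+y. f (x - y) * (g (y - z) * h z) \<partial>lborel) = (\<integral>\<^sup>+y. f (x - y) * g (y - z) * h z \<partial>lborel)"
      by (simp add: mult.assoc)
    also have "\<dots> = (\<integral>\<^sup>+y. f (x - y) * g (y - z) \<partial>lborel) * h z"
      by (rule nn_integral_multc) measurable
    also have "(\<integral>\<^sup>+y. f (x - y) * g (y - z) \<partial>lborel) = (\<integral>\<^sup>+y. f (x - z - y) * g y \<partial>lborel)"
      using nn_integral_lborel_translate[of "\<lambda>y. f (x - z - y) * g y" "-z"] by simp
    finally show "(\<integral>\<^sup>+y. f (x - y) * (g (y - z) * h z) \<partial>lborel)
        = (\<integral>\<^sup>+y. f (x - z - y) * g y \<partial>lborel) * h z" .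
  qed
  finally show ?thesis .
qed

lemma econv_translate:
  fixes g h :: "'a::euclidean_space \<Rightarrow> ennreal"
  assumes [measurable]: "g \<in> borel_measurable borel" "h \<in> borel_measurable borel"
  shows "econv g h (x + v) = econv g (\<lambda>z. h (z + v)) x"
  unfolding econv_def
  using nn_integral_lborel_translate[of "\<lambda>y. g (x + v - y) * h y" v] by simp

lemma econv_mono:
  "(\<And>x. g x \<le> g' x) \<Longrightarrow> (\<And>x. h x \<le> h' x) \<Longrightarrow> econv g h x \<le> econv g' h' x"
  unfolding econv_def by (intro nn_integral_mono mult_mono) auto

lemma econv_add_right:
  fixes g h h' :: "'a::euclidean_space \<Rightarrow> ennreal"
  assumes [measurable]: "g \<in> borel_measurable borel" "h \<in> borel_measurable borel"
    "h' \<in> borel_measurable borel"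
  shows "econv g (\<lambda>y. h y + h' y) x = econv g h x + econv g h' x"
  unfolding econv_def by (simp add: distrib_left nn_integral_add)

lemma econv_add_left:
  fixes g g' h :: "'a::euclidean_space \<Rightarrow> ennreal"
  assumes [measurable]: "g \<in> borel_measurable borel" "h \<in> borel_measurable borel"
    "g' \<in> borel_measurable borel"
  shows "econv (\<lambda>y. g y + g' y) h x = econv g h x + econv g' h x"
  unfolding econv_def by (simp add: distrib_right nn_integral_add)

lemma econv_AE_cong_right:
  assumes "AE y in lborel. h y = h' y"
  shows "econv g h x = econv g h' x"
  unfolding econv_def using assms by (intro nn_integral_cong_AE) auto

lemma conv_eq_econv:
  fixes g h :: "real ^ 'n::finite \<Rightarrow> real"
  assumes [measurable]: "g \<in> borel_measurable borel" "h \<in> borel_measurable borel"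
    and nonneg: "\<And>x. g x \<ge> 0" "\<And>x. h x \<ge> 0"
  shows "conv g h x = enn2real (econv (\<lambda>x. ennreal (g x)) (\<lambda>x. ennreal (h x)) x)"
proof -
  have "conv g h x = (\<integral>y. g (x - y) * h y \<partial>lborel)"
    unfolding conv_def by (rule integral_completion) measurable
  also have "\<dots> = enn2real (\<integral>\<^sup>+y. ennreal (g (x - y) * h y) \<partial>lborel)"
    by (rule integral_eq_nn_integral) (auto simp: nonneg)
  finally show ?thesis by (simp add: econv_def ennreal_mult nonneg)
qed

text \<open>
  A Bochner integral that does not exist is \<open>0\<close>, and the nonnegative integral is monotone along
  almost everywhere inequalities between arbitrary functions; so \<open>f\<close> may be any function that is
  dominated by \<open>G\<close>.
\<close>
lemma abs_conv_le_econv: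
  fixes g f :: "real ^ 'n::finite \<Rightarrow> real"
  assumes nonneg: "\<And>x. g x \<ge> 0" and dom: "AE z in lebesgue. ennreal \<bar>f z\<bar> \<le> G z"
  shows "ennreal \<bar>conv g f x\<bar> \<le> econv (\<lambda>x. ennreal (g x)) G x"
proof (cases "integrable lebesgue (\<lambda>y. g (x - y) * f y)")
  case True
  have "ennreal \<bar>conv g f x\<bar> \<le> (\<integral>\<^sup>+y. ennreal \<bar>g (x - y) * f y\<bar> \<partial>lebesgue)"
    using integral_norm_bound_ennreal[OF True] by (simp add: conv_def)
  also have "\<dots> = (\<integral>\<^sup>+y. ennreal (g (x - y)) * ennreal \<bar>f y\<bar> \<partial>lebesgue)"
    by (simp add: abs_mult ennreal_mult nonneg)
  also have "\<dots> \<le> (\<integral>\<^sup>+y. ennreal (g (x - y)) * G y \<partial>lebesgue)"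
    by (rule nn_integral_mono_AE) (use dom in \<open>auto intro!: mult_left_mono\<close>)
  finally show ?thesis by (simp add: econv_def nn_integral_completion)
next
  case False
  then show ?thesis by (simp add: conv_def not_integrable_integral_eq)
qed

section \<open>The Poisson kernel\<close>

lemma inverse_square_powr:
  assumes "a > 0"
  shows "(a\<^sup>2) powr (- (real m + 1) / 2) = 1 / a ^ (m + 1)"
proof -
  have "(a\<^sup>2) powr (- (real m + 1) / 2) = (a powr 2) powr (- (real m + 1) / 2)"
    using assms by (simp add: powr_numeral)
  also have "\<dots> = a powr (- (real (m + 1)))" 
    unfolding powr_powr by (rule arg_cong[where f="\<lambda>x. a powr x"]) (simp add: field_simps)
  also have "\<dots> = 1 / a ^ (m + 1)"
    using assms by (simp only: powr_minus_divide powr_realpow)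
  finally show ?thesis .
qed

text \<open>
  The kernel without its normalising constant; positivity of that constant is itself derived from the
  estimates below.
\<close>
definition poisson_profile :: "real \<Rightarrow> real ^ 'n::finite \<Rightarrow> real" where
  "poisson_profile t x = t * (t\<^sup>2 + (norm x)\<^sup>2) powr (- (real CARD('n) + 1) / 2)"

lemma poisson_profile_measurable [measurable]:
  "poisson_profile t \<in> borel_measurable (borel :: (real ^ 'n::finite) measure)"
  unfolding poisson_profile_def[abs_def] by measurable

lemma poisson_profile_le:
  fixes x :: "real ^ 'n::finite"
  assumes "t > 0" "a > 0" "a \<le> t \<or> a \<le> norm x"
  shows "poisson_profile t x \<le> t / a ^ (CARD('n) + 1)"
proof -
  have "a\<^sup>2 \<le> t\<^sup>2 + (norm x)\<^sup>2"
    using assms by (auto intro: add_increasing2 add_increasing power_mono)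
  then have "(t\<^sup>2 + (norm x)\<^sup>2) powr (- (real CARD('n) + 1) / 2) \<le> (a\<^sup>2) powr (- (real CARD('n) + 1) / 2)"
    using assms by (intro powr_mono2') (auto simp: field_simps)
  also have "\<dots> = 1 / a ^ (CARD('n) + 1)"
    by (rule inverse_square_powr) fact
  finally show ?thesis
    unfolding poisson_profile_def using assms(1) mult_left_mono[of _ _ t] by fastforce
qed

text \<open>
  The term of the least index \<open>j\<close> whose ball contains \<open>x\<close> already majorises the kernel: either \<open>j = 0\<close>, or \<open>x\<close> lies
  outside the ball of half the radius, where the kernel has already decayed.
\<close>
lemma poisson_profile_shells:
  fixes x :: "real ^ 'n::finite"
  assumes t: "t > 0"
  shows "ennreal (poisson_profile t x)
      \<le> (\<Sum>j. ennreal (2 ^ (CARD('n) + 1) / t ^ CARD('n) * (1/2) ^ (j * (CARD('n) + 1)))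
               * indicator (cball 0 (2 ^ j * t)) x)"
    (is "_ \<le> (\<Sum>j. ?a j * indicator (?B j) x)")
proof -
  define n where "n = CARD('n)"
  have "\<exists>j::nat. norm x \<le> 2 ^ j * t"
  proof -
    obtain j :: nat where "norm x / t < 2 ^ j"
      using real_arch_pow[of 2 "norm x / t"] by auto
    then show ?thesis using t by (auto simp: field_simps intro!: exI[of _ j])
  qed
  then obtain j where j: "norm x \<le> 2 ^ j * t" and least: "\<And>i. i < j \<Longrightarrow> \<not> norm x \<le> 2 ^ i * t"
    using exists_least_iff[of "\<lambda>j::nat. norm x \<le> 2 ^ j * t"] by blast
  have "poisson_profile t x \<le> 2 ^ (n + 1) / t ^ n * (1/2) ^ (j * (n + 1))"
  proof (cases j)
    case 0
    have "poisson_profile t x \<le> t / t ^ (n + 1)"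
      unfolding n_def by (rule poisson_profile_le) (use t in auto)
    also have "\<dots> = 1 / t ^ n" using t by simp
    also have "\<dots> \<le> 2 ^ (n + 1) / t ^ n"
      using t one_le_power[of "2::real" "n+1"] by (intro divide_right_mono) auto
    finally show ?thesis using 0 by simp
  next
    case (Suc i)
    have "poisson_profile t x \<le> t / (2 ^ i * t) ^ (n + 1)"
      unfolding n_def by (rule poisson_profile_le) (use t least[of i] Suc in auto)
    also have "\<dots> = 2 ^ (n + 1) / t ^ n * (1/2) ^ (j * (n + 1))"
    proof -
      have "(2::real) ^ (n + 1) * (1/2) ^ (j * (n + 1)) = (2 * (1/2) ^ j) ^ (n + 1)"
        by (simp only: power_mult_distrib power_mult)
      also have "2 * (1/2::real) ^ j = 1 / 2 ^ i" by (simp add: Suc power_divide)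
      finally have "(2::real) ^ (n + 1) * (1/2) ^ (j * (n + 1)) = 1 / (2 ^ i) ^ (n + 1)"
        by (simp add: power_divide)
      then show ?thesis using t by (simp add: power_mult_distrib field_simps)
    qed
    finally show ?thesis .
  qed
  then have "ennreal (poisson_profile t x) \<le> ?a j * indicator (?B j) x"
    using j by (auto simp: n_def intro!: ennreal_leI)
  also have "\<dots> = (\<Sum>i\<in>{j}. ?a i * indicator (?B i) x)"
    by (subst sum.insert) (auto simp only: finite.emptyI empty_iff sum.empty add_0_right)
  also have "\<dots> \<le> (\<Sum>i. ?a i * indicator (?B i) x)"
    by (rule sum_le_suminf) auto
  finally show ?thesis .
qed

lemma suminf_half_powers: "(\<Sum>j. ennreal (a * (1/2) ^ j)) = ennreal (2 * a)" if "a \<ge> 0"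
proof -
  have "(\<lambda>j. a * (1/2) ^ j) sums (a * (1 / (1 - 1/2)))"
    by (intro sums_mult geometric_sums) auto
  then have "(\<lambda>j. a * (1/2) ^ j) sums (2 * a)" by (simp add: mult.commute)
  then show ?thesis
    using that by (subst suminf_ennreal_eq) auto
qed

text \<open>
  A bound on the averages over the balls of radius \<open>2 ^ j * t\<close> controls the Poisson integral:
  on the \<open>j\<close>-th dyadic shell the kernel is at most a constant times \<open>2 ^ (- j * (n + 1))\<close> times its
  maximum, while the volume grows by \<open>2 ^ (j * n)\<close>; the factors \<open>2 ^ (- j)\<close> that remain are summable.
\<close>
lemma econv_poisson_profile_le:
  fixes G :: "real ^ 'n::finite \<Rightarrow> ennreal"
  assumes [measurable]: "G \<in> borel_measurable borel" and t: "t > 0" and \<mu>: "\<mu> \<ge> 0"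
    and avg: "\<And>j. (\<integral>\<^sup>+z. G z * indicator (cball y (2 ^ j * t)) z \<partial>lborel)
                   \<le> ennreal (\<mu> * (2 ^ j * t) ^ CARD('n))"
  shows "econv (\<lambda>x. ennreal (poisson_profile t x)) G y \<le> ennreal (2 ^ (CARD('n) + 2) * \<mu>)"
proof -
  define n where "n = CARD('n)"
  define a where "a j = 2 ^ (n + 1) / t ^ n * (1/2) ^ (j * (n + 1))" for j :: nat
  have a: "a j \<ge> 0" for j using t by (simp add: a_def)
  have "econv (\<lambda>x. ennreal (poisson_profile t x)) G y
      \<le> (\<integral>\<^sup>+z. (\<Sum>j. ennreal (a j) * (G z * indicator (cball y (2 ^ j * t)) z)) \<partial>lborel)"
    unfolding econv_def
  proof (rule nn_integral_mono)
    fix z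
    have "ennreal (poisson_profile t (y - z)) * G z
        \<le> (\<Sum>j. ennreal (a j) * indicator (cball 0 (2 ^ j * t)) (y - z)) * G z"
      using poisson_profile_shells[OF t, of "y - z"] unfolding a_def n_def
      by (intro mult_right_mono) auto
    also have "\<dots> = (\<Sum>j. ennreal (a j) * indicator (cball 0 (2 ^ j * t)) (y - z) * G z)"
      by (rule ennreal_suminf_multc[symmetric])
    also have "\<dots> = (\<Sum>j. ennreal (a j) * (G z * indicator (cball y (2 ^ j * t)) z))"
      by (rule arg_cong[where f=suminf]) (auto simp: fun_eq_iff indicator_def dist_norm norm_minus_commute)
    finally show "ennreal (poisson_profile t (y - z)) * G z
        \<le> (\<Sum>j. ennreal (a j) * (G z * indicator (cball y (2 ^ j * t)) z))" .
  qed
  also have "\<dots> = (\<Sum>j. ennreal (a j) * (\<integral>\<^sup>+z. G z * indicator (cball y (2 ^ j * t)) z \<partial>lborel))"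
    by (subst nn_integral_suminf) (simp_all add: nn_integral_cmult)
  also have "\<dots> \<le> (\<Sum>j. ennreal (2 ^ (n + 1) * \<mu> * (1/2) ^ j))"
  proof (rule suminf_le)
    fix j
    have "ennreal (a j) * (\<integral>\<^sup>+z. G z * indicator (cball y (2 ^ j * t)) z \<partial>lborel)
        \<le> ennreal (a j) * ennreal (\<mu> * (2 ^ j * t) ^ n)"
      unfolding n_def by (intro mult_left_mono avg) auto
    also have "\<dots> = ennreal (a j * (\<mu> * (2 ^ j * t) ^ n))"
      using a t \<mu> by (simp add: ennreal_mult)
    also have "a j * (\<mu> * (2 ^ j * t) ^ n) = 2 ^ (n + 1) * \<mu> * (1/2) ^ j"
      using t by (simp add: a_def power_mult_distrib power_mult power_add power_divide field_simps)
    finally show "ennreal (a j) * (\<integral>\<^sup>+z. G z * indicator (cball y (2 ^ j * t)) z \<partial>lborel)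
        \<le> ennreal (2 ^ (n + 1) * \<mu> * (1/2) ^ j)" .
  qed auto
  also have "\<dots> = ennreal (2 ^ (CARD('n) + 2) * \<mu>)"
    using \<mu> by (subst suminf_half_powers) (auto simp: n_def)
  finally show ?thesis .
qed

lemma poisson_eq_profile:
  "poisson t (x :: real ^ 'n::finite) = poisson_const TYPE('n) * poisson_profile t x"
  by (simp add: poisson_def poisson_profile_def)

text \<open>
  The constant is defined by division by an integral, so positivity amounts to the convergence
  of that integral.
\<close>
lemma poisson_const_pos: "poisson_const TYPE('n::finite) > 0"
proof -
  let ?q = "poisson_profile 1 :: real ^ 'n \<Rightarrow> real"
  let ?vol = "unit_ball_vol (real CARD('n))"
  have "econv (\<lambda>x. ennreal (?q x)) (\<lambda>_. 1) 0 \<le> ennreal (2 ^ (CARD('n) + 2) * ?vol)"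
    by (rule econv_poisson_profile_le) (auto simp: emeasure_cball)
  moreover have "econv (\<lambda>x. ennreal (?q x)) (\<lambda>_. 1) 0 = (\<integral>\<^sup>+x. ennreal (?q x) \<partial>lborel)"
    by (simp add: econv_def poisson_profile_def)
  ultimately have fin: "(\<integral>\<^sup>+x. ennreal (?q x) \<partial>lborel) < \<infinity>"
    by (simp add: le_less_trans)
  have pos: "(\<integral>\<^sup>+x. ennreal (?q x) \<partial>lborel) \<noteq> 0"
  proof
    assume "(\<integral>\<^sup>+x. ennreal (?q x) \<partial>lborel) = 0"
    then have "AE x in lborel. ennreal (?q x) = 0"
      by (subst (asm) nn_integral_0_iff_AE) auto
    moreover have "ennreal (?q x) \<noteq> 0" for x
    proof -
      have "1 + (norm x)\<^sup>2 \<noteq> 0"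
        using zero_le_power2[of "norm x"] by linarith
      then show ?thesis by (simp add: poisson_profile_def ennreal_eq_0_iff not_le)
    qed
    ultimately have "AE x in (lborel :: (real ^ 'n) measure). False" by simp
    then show False
      by (simp add: ae_filter_eq_bot_iff trivial_limit_def[symmetric])
  qed
  have "(\<integral>x. ?q x \<partial>lebesgue) = enn2real (\<integral>\<^sup>+x. ennreal (?q x) \<partial>lborel)"
    by (subst integral_eq_nn_integral)
       (auto simp: nn_integral_completion poisson_profile_def intro!: measurable_completion)
  also have "\<dots> > 0"
    using fin pos by (simp add: enn2real_positive_iff zero_less_iff_neq_zero)
  finally show ?thesis
    by (simp add: poisson_const_def poisson_profile_def)
qed

lemma poisson_measurable [measurable]:
  "poisson t \<in> borel_measurable (borel :: (real ^ 'n::finite) measure)"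
  unfolding poisson_def[abs_def] by measurable

lemma poisson_pos: "t > 0 \<Longrightarrow> poisson t (x :: real ^ 'n::finite) > 0"
  unfolding poisson_eq_profile using poisson_const_pos[where 'n='n]
  by (simp add: poisson_profile_def add_pos_nonneg)

lemma poisson_nonneg: "t > 0 \<Longrightarrow> poisson t (x :: real ^ 'n::finite) \<ge> 0"
  by (rule less_imp_le[OF poisson_pos])

lemma poisson_le:
  fixes x :: "real ^ 'n::finite"
  assumes "t > 0" "a > 0" "a \<le> t \<or> a \<le> norm x"
  shows "poisson t x \<le> poisson_const TYPE('n) * (t / a ^ (CARD('n) + 1))"
  unfolding poisson_eq_profile
  using poisson_profile_le[OF assms] poisson_const_pos[where 'n='n] by (intro mult_left_mono) auto

lemma poisson_antimono:
  fixes x y :: "real ^ 'n::finite"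
  assumes "t > 0" "norm x \<le> norm y"
  shows "poisson t y \<le> poisson t x"
  unfolding poisson_def using assms poisson_const_pos[where 'n='n]
  by (intro mult_left_mono powr_mono2') (auto simp: add_pos_nonneg power_mono field_simps)

lemma poisson_minus: "poisson t (- x) = poisson t x"
  by (simp add: poisson_def)

text \<open>
  A form of Harnack's inequality: moving by at most \<open>t\<close> multiplies \<open>t\<^sup>2 + |x|\<^sup>2\<close> by at most \<open>9\<close>.
\<close>
lemma poisson_harnack:
  fixes x z :: "real ^ 'n::finite"
  assumes t: "t > 0" and z: "norm z \<le> t"
  shows "(1/3) ^ (CARD('n) + 1) * poisson t x \<le> poisson t (x + z)"
proof -
  let ?e = "- (real CARD('n) + 1) / 2"
  have "norm (x + z) \<le> norm x + t"
    using norm_triangle_ineq[of x z] z by linarith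
  then have "(norm (x + z))\<^sup>2 \<le> (norm x + t)\<^sup>2" by (rule power_mono) auto
  also have "\<dots> \<le> 2 * (norm x)\<^sup>2 + 2 * t\<^sup>2"
    using sum_squares_bound[of "norm x" t] by (simp add: power2_sum)
  finally have "t\<^sup>2 + (norm (x + z))\<^sup>2 \<le> 9 * (t\<^sup>2 + (norm x)\<^sup>2)"
    using zero_le_power2[of t] zero_le_power2[of "norm x"] by argo
  then have "t\<^sup>2 + (norm (x + z))\<^sup>2 \<le> 3\<^sup>2 * (t\<^sup>2 + (norm x)\<^sup>2)" by simp
  then have "(3\<^sup>2 * (t\<^sup>2 + (norm x)\<^sup>2)) powr ?e \<le> (t\<^sup>2 + (norm (x + z))\<^sup>2) powr ?e"
    using t by (intro powr_mono2') (auto simp: add_pos_nonneg field_simps)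
  moreover have "(3\<^sup>2 * (t\<^sup>2 + (norm x)\<^sup>2)) powr ?e = 1 / 3 ^ (CARD('n) + 1) * (t\<^sup>2 + (norm x)\<^sup>2) powr ?e"
    by (subst powr_mult) (simp_all only: inverse_square_powr zero_less_numeral)
  ultimately have "(1/3) ^ (CARD('n) + 1) * (t\<^sup>2 + (norm x)\<^sup>2) powr ?e \<le> (t\<^sup>2 + (norm (x + z))\<^sup>2) powr ?e"
    by (simp add: power_divide)
  from mult_left_mono[OF this, of "poisson_const TYPE('n) * t"] show ?thesis
    using t poisson_const_pos[where 'n='n] by (simp add: poisson_def mult_ac)
qed

abbreviation epoisson :: "real \<Rightarrow> real ^ 'n::finite \<Rightarrow> ennreal" where
  "epoisson t x \<equiv> ennreal (poisson t x)"

lemma econv_poisson_le: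
  fixes G :: "real ^ 'n::finite \<Rightarrow> ennreal"
  assumes [measurable]: "G \<in> borel_measurable borel" and t: "t > 0" and \<mu>: "\<mu> \<ge> 0"
    and avg: "\<And>j. (\<integral>\<^sup>+z. G z * indicator (cball y (2 ^ j * t)) z \<partial>lborel)
                   \<le> ennreal (\<mu> * (2 ^ j * t) ^ CARD('n))"
  shows "econv (epoisson t) G y \<le> ennreal (poisson_const TYPE('n) * 2 ^ (CARD('n) + 2) * \<mu>)"
proof -
  let ?c = "poisson_const TYPE('n)"
  have c: "?c \<ge> 0" using poisson_const_pos[where 'n='n] by simp
  have "econv (epoisson t) G y = ennreal ?c * econv (\<lambda>x. ennreal (poisson_profile t x)) G y"
    unfolding econv_def poisson_eq_profile using t c
    by (subst nn_integral_cmult[symmetric]) (auto simp: ennreal_mult' mult.assoc)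
  also have "\<dots> \<le> ennreal ?c * ennreal (2 ^ (CARD('n) + 2) * \<mu>)"
    by (intro mult_left_mono econv_poisson_profile_le t \<mu> avg) auto
  finally show ?thesis using c \<mu> by (simp add: ennreal_mult mult.assoc)
qed

section \<open>Nontangential approach\<close>

lemma set_nn_integral_disjoint_family_le:
  fixes G :: "'a::euclidean_space \<Rightarrow> ennreal" and A :: "nat \<Rightarrow> 'a set"
  assumes [measurable]: "G \<in> borel_measurable borel" and A: "\<And>m. A m \<in> sets borel"
    and "disjoint_family A"
  shows "(\<Sum>m. \<integral>\<^sup>+z. G z * indicator (A m) z \<partial>lborel) \<le> (\<integral>\<^sup>+z. G z \<partial>lborel)"
proof -
  let ?\<nu> = "density lborel G"
  have "(\<Sum>m. \<integral>\<^sup>+z. G z * indicator (A m) z \<partial>lborel) = (\<Sum>m. emeasure ?\<nu> (A m))"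
    using A by (simp add: emeasure_density)
  also have "\<dots> = emeasure ?\<nu> (\<Union>m. A m)"
    using A assms(3) by (intro suminf_emeasure) auto
  also have "\<dots> \<le> emeasure ?\<nu> UNIV"
    by (rule emeasure_mono) auto
  also have "\<dots> = (\<integral>\<^sup>+z. G z \<partial>lborel)"
    by (subst emeasure_density) auto
  finally show ?thesis .
qed

text \<open>
  The Hardy--Littlewood argument: among balls on each of which \<open>G\<close> has mass at least \<open>\<mu>\<close> times the
  \<open>n\<close>-th power of the radius, Vitali's lemma picks disjoint ones whose dilates cover everything,
  and disjointness bounds the sum of their masses by the total mass.
\<close>
lemma emeasure_le_of_heavy_ball_cover:
  fixes G :: "'a::euclidean_space \<Rightarrow> ennreal"
  assumes [measurable]: "G \<in> borel_measurable borel"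
    and fin: "(\<integral>\<^sup>+z. G z \<partial>lborel) < \<infinity>" and \<mu>: "\<mu> > 0"
    and heavy: "\<And>y \<rho>. (y, \<rho>) \<in> I \<Longrightarrow> \<rho> > 0 \<and>
        ennreal (\<mu> * \<rho> ^ DIM('a)) \<le> (\<integral>\<^sup>+z. G z * indicator (cball y \<rho>) z \<partial>lborel)"
    and S: "S \<subseteq> (\<Union>(y, \<rho>)\<in>I. cball y (2 * \<rho>))"
  shows "emeasure lborel S
      \<le> ennreal (unit_ball_vol (real DIM('a)) * 10 ^ DIM('a) / \<mu>) * (\<integral>\<^sup>+z. G z \<partial>lborel)"
proof -
  let ?n = "DIM('a)"
  define V where "V = unit_ball_vol (real ?n)"
  have V: "V \<ge> 0" by (simp add: V_def)
  obtain g where g: "(\<integral>\<^sup>+z. G z \<partial>lborel) = ennreal g" "g \<ge> 0"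
    using fin by (cases "\<integral>\<^sup>+z. G z \<partial>lborel") auto
  have radius: "\<rho> \<le> max 1 (g / \<mu>)" if "(y, \<rho>) \<in> I" for y \<rho>
  proof (cases "\<rho> \<le> 1")
    case False
    have "ennreal (\<mu> * \<rho> ^ ?n) \<le> (\<integral>\<^sup>+z. G z * indicator (cball y \<rho>) z \<partial>lborel)"
      using heavy[OF that] by simp
    also have "\<dots> \<le> (\<integral>\<^sup>+z. G z \<partial>lborel)"
      by (rule nn_integral_mono) (auto simp: indicator_def)
    finally have "\<mu> * \<rho> ^ ?n \<le> g"
      using g by simp
    moreover have "\<rho> \<le> \<rho> ^ ?n"
      using False by (intro self_le_power) auto
    ultimately have "\<mu> * \<rho> \<le> g"
      using \<mu> by (meson less_imp_le mult_left_mono order_trans)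
    then show ?thesis using \<mu> by (simp add: field_simps le_max_iff_disj)
  qed auto
  have "S \<subseteq> (\<Union>i\<in>I. cball (fst i) (2 * snd i))"
    using S by force
  moreover have "0 < 2 * snd i \<and> 2 * snd i \<le> 2 * max 1 (g / \<mu>)" if "i \<in> I" for i
    using heavy[of "fst i" "snd i"] radius[of "fst i" "snd i"] that by auto
  ultimately obtain C where C: "countable C" "C \<subseteq> I"
    "pairwise (\<lambda>i j. disjnt (cball (fst i) (2 * snd i)) (cball (fst j) (2 * snd j))) C"
    "S \<subseteq> (\<Union>i\<in>C. cball (fst i) (5 * (2 * snd i)))"
    by (rule Vitali_covering_lemma_cballs[where a=fst and r="\<lambda>i. 2 * snd i"]) blast
  (* Subadditivity and disjoint additivity are used along sequences, so the countable family is
     indexed by natural numbers, with empty sets at the unused indices. *)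
  define e where "e = to_nat_on C"
  have e: "inj_on e C" unfolding e_def by (rule inj_on_to_nat_on) (rule C(1))
  define A where "A m = (\<Union>i\<in>{i\<in>C. e i = m}. cball (fst i) (snd i))" for m
  define B where "B m = (\<Union>i\<in>{i\<in>C. e i = m}. cball (fst i) (10 * snd i))" for m
  have slot: "{i\<in>C. e i = m} = {} \<or> (\<exists>i\<in>C. {i\<in>C. e i = m} = {i})" for m
  proof (cases "\<exists>i\<in>C. e i = m")
    case True
    then obtain i where "i \<in> C" "e i = m" by blast
    then have "{i\<in>C. e i = m} = {i}" using e unfolding inj_on_def by blast
    then show ?thesis using \<open>i \<in> C\<close> by blast
  qed blast
  have meas: "A m \<in> sets borel" "B m \<in> sets borel" for m
  proof -
    have "countable {i\<in>C. e i = m}"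
      by (rule countable_subset[OF _ C(1)]) blast
    then show "A m \<in> sets borel" "B m \<in> sets borel"
      unfolding A_def B_def by (auto intro: sets.countable_UN')
  qed
  have "disjoint_family A"
    unfolding disjoint_family_on_def
  proof (intro ballI impI)
    fix m m' :: nat assume "m \<noteq> m'"
    have sep: "z \<notin> cball (fst j) (snd j)"
      if "i \<in> C" "j \<in> C" "e i = m" "e j = m'" "z \<in> cball (fst i) (snd i)" for i j z
    proof -
      have "snd i > 0" "snd j > 0"
        using heavy[of "fst i" "snd i"] heavy[of "fst j" "snd j"] that C(2) by auto
      then have "cball (fst i) (snd i) \<subseteq> cball (fst i) (2 * snd i)"
          "cball (fst j) (snd j) \<subseteq> cball (fst j) (2 * snd j)"
        by (simp_all add: subset_cball)
      moreover have "i \<noteq> j" using that \<open>m \<noteq> m'\<close> by auto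
      then have "disjnt (cball (fst i) (2 * snd i)) (cball (fst j) (2 * snd j))"
        using C(3) that(1,2) by (rule_tac pairwiseD)
      ultimately show ?thesis using that(5) unfolding disjnt_iff by blast
    qed
    show "A m \<inter> A m' = {}"
    proof (rule ccontr)
      assume "A m \<inter> A m' \<noteq> {}"
      then obtain z where z: "z \<in> A m" "z \<in> A m'" by blast
      obtain i where "i \<in> C" "e i = m" "z \<in> cball (fst i) (snd i)"
        using z(1) unfolding A_def by blast
      moreover obtain j where "j \<in> C" "e j = m'" "z \<in> cball (fst j) (snd j)"
        using z(2) unfolding A_def by blast
      ultimately show False using sep by metis
    qed
  qed
  have "emeasure lborel S \<le> emeasure lborel (\<Union>m. B m)"
  proof (rule emeasure_mono)
    show "S \<subseteq> (\<Union>m. B m)"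
    proof
      fix x assume "x \<in> S"
      then obtain i where "i \<in> C" "x \<in> cball (fst i) (10 * snd i)" using C(4) by auto
      then show "x \<in> (\<Union>m. B m)" unfolding B_def by blast
    qed
  qed (use meas in auto)
  also have "\<dots> \<le> (\<Sum>m. emeasure lborel (B m))"
    using meas by (intro emeasure_subadditive_countably) auto
  also have "\<dots> \<le> (\<Sum>m. ennreal (V * 10 ^ ?n / \<mu>) * (\<integral>\<^sup>+z. G z * indicator (A m) z \<partial>lborel))"
  proof (rule suminf_le)
    fix m
    show "emeasure lborel (B m) \<le> ennreal (V * 10 ^ ?n / \<mu>) * (\<integral>\<^sup>+z. G z * indicator (A m) z \<partial>lborel)"
      using slot[of m]
    proof (elim disjE bexE)
      assume "{i\<in>C. e i = m} = {}"
      then have "B m = {}" unfolding B_def by (simp only: UN_empty)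
      then show ?thesis by simp
    next
      fix i assume i: "i \<in> C" "{i\<in>C. e i = m} = {i}"
      have AB: "A m = cball (fst i) (snd i)" "B m = cball (fst i) (10 * snd i)"
        by (simp_all add: A_def B_def i(2))
      have h: "snd i > 0" "ennreal (\<mu> * snd i ^ ?n)
          \<le> (\<integral>\<^sup>+z. G z * indicator (cball (fst i) (snd i)) z \<partial>lborel)"
        using heavy[of "fst i" "snd i"] i(1) C(2) by auto
      have "emeasure lborel (B m) = ennreal (V * 10 ^ ?n / \<mu> * (\<mu> * snd i ^ ?n))"
        using h(1) \<mu> by (simp add: AB emeasure_cball V_def power_mult_distrib mult_ac)
      also have "\<dots> = ennreal (V * 10 ^ ?n / \<mu>) * ennreal (\<mu> * snd i ^ ?n)"
        using h(1) \<mu> V by (intro ennreal_mult) auto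
      also have "\<dots> \<le> ennreal (V * 10 ^ ?n / \<mu>) * (\<integral>\<^sup>+z. G z * indicator (A m) z \<partial>lborel)"
        unfolding AB by (intro mult_left_mono h) auto
      finally show ?thesis .
    qed
  qed auto
  also have "\<dots> = ennreal (V * 10 ^ ?n / \<mu>) * (\<Sum>m. \<integral>\<^sup>+z. G z * indicator (A m) z \<partial>lborel)"
    by (rule ennreal_suminf_cmult)
  also have "\<dots> \<le> ennreal (V * 10 ^ ?n / \<mu>) * (\<integral>\<^sup>+z. G z \<partial>lborel)"
    by (intro mult_left_mono set_nn_integral_disjoint_family_le meas \<open>disjoint_family A\<close>) auto
  finally show ?thesis by (simp add: V_def)
qed

text \<open>
  The aperture \<open>2\<close> absorbs cones whose vertex is displaced horizontally by less than their height.
\<close>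
definition nt_superlevel :: "(real ^ 'n::finite \<Rightarrow> ennreal) \<Rightarrow> real \<Rightarrow> (real ^ 'n) set" where
  "nt_superlevel G \<alpha> = {x. \<exists>y s. s > 0 \<and> norm (y - x) < 2 * s \<and> econv (epoisson s) G y > ennreal \<alpha>}"

lemma open_nt_superlevel: "open (nt_superlevel G \<alpha>)"
proof -
  have "nt_superlevel G \<alpha>
      = (\<Union>(y, s)\<in>{(y, s). s > 0 \<and> econv (epoisson s) G y > ennreal \<alpha>}. ball y (2 * s))"
    unfolding nt_superlevel_def by (auto simp: dist_norm; blast)
  then show ?thesis by (auto intro!: open_UN)
qed

text \<open>
  The product of the Vitali constant \<open>10 ^ n * |B(0, 1)|\<close> and of the constant in the comparison of Poisson
  integrals with averages.
\<close>
definition nt_const :: "'n::finite itself \<Rightarrow> real" where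
  "nt_const _ = unit_ball_vol (real CARD('n)) * 10 ^ CARD('n) * (poisson_const TYPE('n) * 2 ^ (CARD('n) + 2))"

lemma nt_const_nonneg: "nt_const TYPE('n::finite) \<ge> 0"
  using poisson_const_pos[where 'n='n] by (simp add: nt_const_def)

lemma nt_superlevel_weak_type:
  fixes G :: "real ^ 'n::finite \<Rightarrow> ennreal"
  assumes [measurable]: "G \<in> borel_measurable borel"
    and fin: "(\<integral>\<^sup>+z. G z \<partial>lborel) < \<infinity>" and \<alpha>: "\<alpha> > 0"
  shows "emeasure lborel (nt_superlevel G \<alpha>)
      \<le> ennreal (nt_const TYPE('n) / \<alpha>) * (\<integral>\<^sup>+z. G z \<partial>lborel)"
proof -
  let ?c = "poisson_const TYPE('n) * 2 ^ (CARD('n) + 2)"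
  define \<mu> where "\<mu> = \<alpha> / ?c"
  have c: "?c > 0" using poisson_const_pos[where 'n='n] by simp
  then have \<mu>: "\<mu> > 0" "?c * \<mu> = \<alpha>" using \<alpha> by (auto simp: \<mu>_def)
  define I where "I = {(y :: real ^ 'n, \<rho>). \<rho> > 0 \<and>
      ennreal (\<mu> * \<rho> ^ CARD('n)) \<le> (\<integral>\<^sup>+z. G z * indicator (cball y \<rho>) z \<partial>lborel)}"
  have "nt_superlevel G \<alpha> \<subseteq> (\<Union>(y, \<rho>)\<in>I. cball y (2 * \<rho>))"
  proof
    fix x assume "x \<in> nt_superlevel G \<alpha>"
    then obtain y s where ys: "s > 0" "norm (y - x) < 2 * s" "econv (epoisson s) G y > ennreal \<alpha>"
      by (auto simp: nt_superlevel_def)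
    have "\<exists>j. \<not> (\<integral>\<^sup>+z. G z * indicator (cball y (2 ^ j * s)) z \<partial>lborel)
                 \<le> ennreal (\<mu> * (2 ^ j * s) ^ CARD('n))"
    proof (rule ccontr)
      assume "\<not> ?thesis"
      then have "econv (epoisson s) G y \<le> ennreal (?c * \<mu>)"
        using ys \<mu> by (intro econv_poisson_le) auto
      then show False using ys(3) \<mu> by simp
    qed
    then obtain j where "(y, 2 ^ j * s) \<in> I"
      using ys(1) by (auto simp: I_def not_le intro: less_imp_le)
    moreover have "1 * s \<le> 2 ^ j * s"
      using ys(1) by (intro mult_right_mono) auto
    then have "x \<in> cball y (2 * (2 ^ j * s))"
      using ys(2) by (simp add: dist_norm)
    ultimately show "x \<in> (\<Union>(y, \<rho>)\<in>I. cball y (2 * \<rho>))" by blast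
  qed
  then have "emeasure lborel (nt_superlevel G \<alpha>)
      \<le> ennreal (unit_ball_vol (real DIM(real ^ 'n)) * 10 ^ DIM(real ^ 'n) / \<mu>) * (\<integral>\<^sup>+z. G z \<partial>lborel)"
    by (intro emeasure_le_of_heavy_ball_cover[where I=I] fin \<mu>(1)) (auto simp: I_def)
  then show ?thesis by (simp add: nt_const_def \<mu>_def)
qed

section \<open>The kernel and the function \<open>r\<^sub>K\<close>\<close>

locale radial_kernel =
  fixes K :: "real ^ 'n::finite \<Rightarrow> ennreal"
  assumes K_integrable: "(\<integral>\<^sup>+ x. K x \<partial>lebesgue) < \<infinity>"
    and K_decreasing: "\<And>x y. norm x \<le> norm y \<Longrightarrow> K x \<ge> K y"
    and K_unbounded: "(K \<longlongrightarrow> \<infinity>) (at 0)"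
begin

text \<open>
  A superlevel set of \<open>K\<close> contains, with a point, the whole ball through it. So \<open>K\<close> is Borel, and
  Fubini's theorem applies without passing to completed products.
\<close>
lemma K_measurable [measurable]: "K \<in> borel_measurable borel"
proof -
  define e :: "real ^ 'n" where "e = (SOME e. e \<in> Basis)"
  have e: "norm e = 1"
    unfolding e_def by (rule norm_Basis) (simp add: some_in_eq)
  define k where "k r = K (max r 0 *\<^sub>R e)" for r
  have "mono (\<lambda>r. k (- r))"
    unfolding k_def by (intro monoI K_decreasing) (simp add: e)
  then have "is_interval {r. a < k (- r)}" for a
    unfolding is_interval_1 by (auto dest: monoD intro: less_le_trans)
  then have "(\<lambda>r. k (- r)) \<in> borel_measurable borel"
    by (intro borel_measurableI_greater) (auto intro: real_interval_borel_measurable)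
  then have "(\<lambda>x :: real ^ 'n. k (- (- norm x))) \<in> borel_measurable borel"
    by (rule measurable_compose[rotated]) measurable
  moreover have "k (- (- norm x)) = K x" for x
    by (intro antisym) (auto simp: k_def e intro!: K_decreasing)
  ultimately show ?thesis by (simp cong: measurable_cong)
qed

definition mass :: real where "mass = enn2real (\<integral>\<^sup>+x. K x \<partial>lborel)"

lemma mass: "(\<integral>\<^sup>+x. K x \<partial>lborel) = ennreal mass" and mass_nonneg: "mass \<ge> 0"
  using K_integrable by (auto simp: mass_def nn_integral_completion)

text \<open>
  The kernel as it enters the real-valued convolutions: the value \<open>\<infinity>\<close> is replaced by \<open>0\<close>.
\<close>
definition finite_part :: "real ^ 'n \<Rightarrow> real" where "finite_part x = enn2real (K x)"

lemma finite_part_measurable [measurable]: "finite_part \<in> borel_measurable borel"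
  unfolding finite_part_def[abs_def] by measurable

lemma finite_part_nonneg: "finite_part x \<ge> 0"
  by (simp add: finite_part_def)

lemma finite_part_le: "ennreal (finite_part x) \<le> K x"
  by (cases "K x") (auto simp: finite_part_def)

lemma finite_part_AE: "AE x in lborel. ennreal (finite_part x) = K x"
proof -
  have "AE x in lborel. K x \<noteq> \<infinity>"
    by (rule nn_integral_PInf_AE) (auto simp: mass)
  then show ?thesis
    by (rule eventually_mono) (auto simp: finite_part_def less_top)
qed

text \<open>
  The value of \<open>P\<^sub>t * K\<close> at the origin, which stands in for the essential supremum in the definition of
  \<open>r\<^sub>K\<close>; the two are comparable.
\<close>
definition peak :: "real \<Rightarrow> ennreal" where
  "peak t = econv (epoisson t) K 0"

lemma peak_eq: "peak t = (\<integral>\<^sup>+y. epoisson t y * K y \<partial>lborel)"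
  by (simp add: peak_def econv_def poisson_minus)

lemma epoisson_le: "epoisson t (y :: real ^ 'n) \<le> ennreal (poisson_const TYPE('n) / t ^ CARD('n))"
  if "t > 0"
  using poisson_le[of t t y] that by (auto intro!: ennreal_leI)

lemma peak_le: 
  assumes "t > 0"
  shows "peak t \<le> ennreal (poisson_const TYPE('n) / t ^ CARD('n) * mass)"
proof -
  have "peak t \<le> (\<integral>\<^sup>+y. ennreal (poisson_const TYPE('n) / t ^ CARD('n)) * K y \<partial>lborel)"
    unfolding peak_eq by (intro nn_integral_mono mult_right_mono epoisson_le assms) auto
  also have "\<dots> = ennreal (poisson_const TYPE('n) / t ^ CARD('n)) * ennreal mass"
    by (simp add: nn_integral_cmult mass)
  also have "\<dots> = ennreal (poisson_const TYPE('n) / t ^ CARD('n) * mass)"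
    using mass_nonneg poisson_const_pos[where 'n='n] assms by (intro ennreal_mult[symmetric]) auto
  finally show ?thesis .
qed

lemma peak_finite: "t > 0 \<Longrightarrow> peak t < \<infinity>"
  by (rule le_less_trans[OF peak_le]) auto

text \<open>
  Both factors are radially decreasing. Where \<open>|y| \<ge> |x - y|\<close> the value \<open>K y\<close> is at most \<open>K (x - y)\<close>,
  and elsewhere \<open>P\<^sub>t (x - y) \<le> P\<^sub>t y\<close>; each part contributes at most the value at \<open>0\<close>.
\<close>
lemma econv_poisson_K_le: "t > 0 \<Longrightarrow> econv (epoisson t) K x \<le> 2 * peak t"
proof -
  assume t: "t > 0"
  have "econv (epoisson t) K x \<le> (\<integral>\<^sup>+y. epoisson t (x - y) * K (x - y) + epoisson t y * K y \<partial>lborel)"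
    unfolding econv_def
  proof (rule nn_integral_mono)
    fix y
    show "epoisson t (x - y) * K y \<le> epoisson t (x - y) * K (x - y) + epoisson t y * K y"
    proof (cases "norm (x - y) \<le> norm y")
      case True
      then have "epoisson t (x - y) * K y \<le> epoisson t (x - y) * K (x - y)"
        by (intro mult_left_mono K_decreasing) auto
      then show ?thesis by (simp add: add_increasing2)
    next
      case False
      then have "epoisson t (x - y) * K y \<le> epoisson t y * K y"
        using t by (intro mult_right_mono ennreal_leI poisson_antimono) auto
      then show ?thesis by (simp add: add_increasing)
    qed
  qed
  also have "\<dots> = (\<integral>\<^sup>+y. epoisson t (x - y) * K (x - y) \<partial>lborel) + peak t"
    by (simp add: nn_integral_add peak_eq)
  also have "(\<integral>\<^sup>+y. epoisson t (x - y) * K (x - y) \<partial>lborel) = peak t"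
    unfolding peak_eq by (rule nn_integral_lborel_reflect) measurable
  finally show ?thesis by (simp add: mult_2)
qed

lemma econv_poisson_K_ge:
  assumes t: "t > 0" and x: "norm x \<le> t"
  shows "ennreal ((1/3) ^ (CARD('n) + 1)) * peak t \<le> econv (epoisson t) K x"
proof -
  have "ennreal ((1/3) ^ (CARD('n) + 1)) * peak t
      = (\<integral>\<^sup>+y. ennreal ((1/3) ^ (CARD('n) + 1)) * (epoisson t y * K y) \<partial>lborel)"
    unfolding peak_eq by (rule nn_integral_cmult[symmetric]) measurable
  also have "\<dots> \<le> econv (epoisson t) K x"
    unfolding econv_def
  proof (rule nn_integral_mono)
    fix y
    have "(1/3) ^ (CARD('n) + 1) * poisson t y \<le> poisson t (x - y)"
      using poisson_harnack[OF t x, of "-y"] by (simp add: poisson_minus add.commute)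
    then show "ennreal ((1/3) ^ (CARD('n) + 1)) * (epoisson t y * K y) \<le> epoisson t (x - y) * K y"
      unfolding mult.assoc[symmetric] using poisson_nonneg[OF t]
      by (intro mult_right_mono) (subst ennreal_mult[symmetric], auto intro!: ennreal_leI)
  qed
  finally show ?thesis .
qed

lemma conv_poisson_K:
  assumes "t > 0"
  shows "ennreal \<bar>conv (poisson t) (\<lambda>y. enn2real (K y)) x\<bar> = econv (epoisson t) K x"
proof -
  have "econv (epoisson t) (\<lambda>y. ennreal (finite_part y)) x = econv (epoisson t) K x"
    by (rule econv_AE_cong_right) (rule finite_part_AE)
  moreover have "econv (epoisson t) K x < \<infinity>"
    using econv_poisson_K_le[OF assms, of x] peak_finite[OF assms]
    by (simp add: ennreal_mult_less_top order_le_less_trans)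
  moreover have "conv (poisson t) finite_part x
      = enn2real (econv (epoisson t) (\<lambda>y. ennreal (finite_part y)) x)"
    by (rule conv_eq_econv) (auto simp: poisson_nonneg[OF assms] finite_part_nonneg)
  ultimately show ?thesis
    by (simp add: finite_part_def[abs_def])
qed

definition rpeak :: "real \<Rightarrow> real" where "rpeak t = enn2real (peak t)"

lemma peak_rpeak: "t > 0 \<Longrightarrow> peak t = ennreal (rpeak t)"
  using peak_finite[of t] by (simp add: rpeak_def)

lemma K_near_zero: "\<exists>\<delta>>0. \<forall>x. norm x \<le> \<delta> \<longrightarrow> x \<noteq> 0 \<longrightarrow> ennreal B \<le> K x"
proof -
  have "eventually (\<lambda>x. ennreal B < K x) (at 0)"
    using K_unbounded by (rule order_tendstoD) simp
  then obtain d where d: "d > 0" "\<And>x. x \<noteq> 0 \<Longrightarrow> dist x 0 < d \<Longrightarrow> ennreal B < K x"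
    unfolding eventually_at by blast
  show ?thesis
    using d by (intro exI[of _ "d/2"]) (auto intro!: less_imp_le)
qed

text \<open>
  On the ball of radius \<open>t\<close> the kernel \<open>P\<^sub>t\<close> is comparable with \<open>t ^ (- n)\<close>, so the peak is at least a
  multiple of the smallest value of \<open>K\<close> on that ball.
\<close>
lemma peak_tends_to_infinity: "\<exists>\<delta>>0. \<forall>t. 0 < t \<longrightarrow> t \<le> \<delta> \<longrightarrow> ennreal B \<le> peak t"
proof -
  let ?V = "unit_ball_vol (real CARD('n))"
  let ?c = "poisson_const TYPE('n)"
  define b where "b = (1/3) ^ (CARD('n) + 1) * ?c * ?V"
  have b: "b > 0" using poisson_const_pos[where 'n='n] by (simp add: b_def)
  have V: "?V \<noteq> 0" using unit_ball_vol_pos[of "real CARD('n)"] by linarith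
  obtain \<delta> where \<delta>: "\<delta> > 0" "\<And>x. norm x \<le> \<delta> \<Longrightarrow> x \<noteq> 0 \<Longrightarrow> ennreal (max B 0 / b) \<le> K x"
    using K_near_zero by blast
  have "ennreal B \<le> peak t" if t: "0 < t" "t \<le> \<delta>" for t
  proof -
    have p: "(1/3) ^ (CARD('n) + 1) * (?c / t ^ CARD('n)) \<le> poisson t y" if "norm y \<le> t" for y :: "real ^ 'n"
    proof -
      have "poisson t (0 :: real ^ 'n) = ?c * (t * (t\<^sup>2) powr (- (real CARD('n) + 1) / 2))"
        by (simp add: poisson_def)
      also have "\<dots> = ?c / t ^ CARD('n)"
        using t by (subst inverse_square_powr) auto
      finally show ?thesis
        using poisson_harnack[OF t(1) that, of 0] by simp
    qed
    have "ennreal B \<le> ennreal (max B 0)" by (rule ennreal_leI) simp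
    also have "max B 0 = (1/3) ^ (CARD('n) + 1) * (?c / t ^ CARD('n)) * (max B 0 / b) * (?V * t ^ CARD('n))"
      using t poisson_const_pos[where 'n='n] V by (simp add: b_def field_simps)
    also have "ennreal \<dots> = (\<integral>\<^sup>+y. ennreal ((1/3) ^ (CARD('n) + 1) * (?c / t ^ CARD('n)) * (max B 0 / b))
          * indicator (cball (0 :: real ^ 'n) t) y \<partial>lborel)"
      using t b poisson_const_pos[where 'n='n]
      by (subst nn_integral_cmult_indicator) (auto simp: emeasure_cball ennreal_mult[symmetric])
    also have "\<dots> \<le> peak t"
      unfolding peak_eq
    proof (rule nn_integral_mono_AE)
      show "AE y in lborel. ennreal ((1/3) ^ (CARD('n) + 1) * (?c / t ^ CARD('n)) * (max B 0 / b))
          * indicator (cball (0 :: real ^ 'n) t) y \<le> epoisson t y * K y"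
        using AE_lborel_singleton[of 0]
      proof eventually_elim
        case (elim y)
        have "ennreal ((1/3) ^ (CARD('n) + 1) * (?c / t ^ CARD('n)) * (max B 0 / b)) \<le> epoisson t y * K y"
          if y: "norm y \<le> t"
        proof -
          have "ennreal ((1/3) ^ (CARD('n) + 1) * (?c / t ^ CARD('n)) * (max B 0 / b))
              = ennreal ((1/3) ^ (CARD('n) + 1) * (?c / t ^ CARD('n))) * ennreal (max B 0 / b)"
            using t b poisson_const_pos[where 'n='n] by (intro ennreal_mult) auto
          also have "\<dots> \<le> epoisson t y * K y"
            using y elim t by (intro mult_mono ennreal_leI p \<delta>(2)) auto
          finally show ?thesis .
        qed
        then show ?case by (auto simp: indicator_def)
      qed
    qed
    finally show ?thesis .
  qed
  then show ?thesis using \<delta>(1) by blast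
qed

lemma peak_pos: "t > 0 \<Longrightarrow> peak t > 0"
proof (rule ccontr)
  assume t: "t > 0" and "\<not> peak t > 0"
  then have "(\<integral>\<^sup>+y. epoisson t y * K y \<partial>lborel) = 0" by (simp add: peak_eq)
  then have "AE y in lborel. epoisson t y * K y = 0"
    by (subst (asm) nn_integral_0_iff_AE) auto
  moreover have "epoisson t y \<noteq> 0" for y :: "real ^ 'n"
    using poisson_pos[OF t, of y] by (simp add: ennreal_eq_0_iff)
  ultimately have "AE y in lborel. K y = 0" by simp
  then have "AE y in lborel. epoisson s y * K y = 0" for s
    by (rule eventually_mono) auto
  then have zero: "peak s = 0" for s
    unfolding peak_eq by (subst nn_integral_0_iff_AE) auto
  obtain \<delta> where "\<delta> > 0" "\<And>t. 0 < t \<Longrightarrow> t \<le> \<delta> \<Longrightarrow> ennreal 1 \<le> peak t"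
    using peak_tends_to_infinity by blast
  then show False using zero[of \<delta>] by fastforce
qed

lemma rpeak_pos: "t > 0 \<Longrightarrow> rpeak t > 0"
  using peak_pos[of t] peak_finite[of t] by (simp add: rpeak_def enn2real_positive_iff)

definition peak_sup :: "real \<Rightarrow> ennreal" where
  "peak_sup t = esssup lebesgue (\<lambda>x :: real ^ 'n. ennreal \<bar>conv (poisson t) (\<lambda>y. enn2real (K y)) x\<bar>)"

text \<open>
  The supremum is only an essential one, so the lower bound needs a set of positive measure on which
  \<open>P\<^sub>t * K\<close> is large; Harnack's inequality provides the ball of radius \<open>t\<close>.
\<close>
lemma peak_sup_bounds:
  assumes t: "t > 0"
  shows "ennreal ((1/3) ^ (CARD('n) + 1)) * peak t \<le> peak_sup t" "peak_sup t \<le> 2 * peak t"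
proof -
  have eq: "peak_sup t = esssup lebesgue (econv (epoisson t) K)"
    unfolding peak_sup_def using conv_poisson_K[OF t] by simp
  show "peak_sup t \<le> 2 * peak t"
    unfolding eq using econv_poisson_K_le[OF t]
    by (intro esssup_I) (auto intro!: measurable_completion)
  show "ennreal ((1/3) ^ (CARD('n) + 1)) * peak t \<le> peak_sup t"
  proof (rule ccontr)
    assume less: "\<not> ?thesis"
    have "AE x in lebesgue. econv (epoisson t) K x \<le> peak_sup t"
      unfolding eq by (rule esssup_AE)
    then have "AE x in lebesgue. x \<notin> cball (0 :: real ^ 'n) t"
    proof (rule eventually_mono)
      fix x :: "real ^ 'n" assume "econv (epoisson t) K x \<le> peak_sup t"
      then show "x \<notin> cball 0 t"
        using order_trans[OF econv_poisson_K_ge[OF t]] less by (metis mem_cball_0)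
    qed
    then have "emeasure lebesgue (cball (0 :: real ^ 'n) t) = 0"
      by (subst (asm) AE_iff_measurable[where N="cball 0 t"]) auto
    moreover have "unit_ball_vol (real CARD('n)) * t ^ CARD('n) > 0"
      using t by (intro mult_pos_pos) auto
    ultimately show False using t by (simp add: emeasure_cball ennreal_eq_0_iff)
  qed
qed

lemma rK_power_eq: "rK K t ^ CARD('n) = 1 / enn2real (peak_sup t)" and rK_pos: "rK K t > 0" if t: "t > 0"
proof -
  have "0 < ennreal ((1/3) ^ (CARD('n) + 1)) * peak t"
    using peak_pos[OF t] by (simp add: ennreal_zero_less_mult_iff)
  then have "peak_sup t > 0"
    using peak_sup_bounds(1)[OF t] by (rule less_le_trans)
  moreover have "peak_sup t < \<infinity>"
    using peak_sup_bounds(2)[OF t] peak_finite[OF t]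
    by (simp add: ennreal_mult_less_top order_le_less_trans)
  ultimately have pos: "enn2real (peak_sup t) > 0" by (simp add: enn2real_positive_iff)
  have rK: "rK K t = enn2real (peak_sup t) powr (- 1 / real CARD('n))"
    by (simp add: rK_def peak_sup_def)
  show "rK K t > 0" using pos by (simp add: rK)
  have "rK K t ^ CARD('n) = rK K t powr (real CARD('n))"
    using \<open>rK K t > 0\<close> by (simp add: powr_realpow)
  also have "\<dots> = enn2real (peak_sup t) powr (- 1)"
    by (simp add: rK powr_powr)
  also have "\<dots> = 1 / enn2real (peak_sup t)"
    using pos by (simp add: powr_minus_divide)
  finally show "rK K t ^ CARD('n) = 1 / enn2real (peak_sup t)" .
qed

lemma rK_power_bounds:
  assumes t: "t > 0"
  shows "1 / (2 * rpeak t) \<le> rK K t ^ CARD('n)"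
    and "rK K t ^ CARD('n) \<le> 3 ^ (CARD('n) + 1) / rpeak t"
proof -
  have "0 < rK K t ^ CARD('n)" using rK_pos[OF t] by simp
  then have pos: "enn2real (peak_sup t) > 0"
    unfolding rK_power_eq[OF t] by simp
  then have fin: "peak_sup t = ennreal (enn2real (peak_sup t))"
    by (simp add: enn2real_positive_iff)
  note a = rpeak_pos[OF t]
  have "ennreal ((1/3) ^ (CARD('n) + 1) * rpeak t) = ennreal ((1/3) ^ (CARD('n) + 1)) * peak t"
    unfolding peak_rpeak[OF t] using a by (intro ennreal_mult) auto
  also have "\<dots> \<le> ennreal (enn2real (peak_sup t))"
    unfolding fin[symmetric] by (rule peak_sup_bounds(1)[OF t])
  finally have "ennreal ((1/3) ^ (CARD('n) + 1) * rpeak t) \<le> ennreal (enn2real (peak_sup t))" .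
  then have "(1/3) ^ (CARD('n) + 1) * rpeak t \<le> enn2real (peak_sup t)"
    using pos by simp
  then show "rK K t ^ CARD('n) \<le> 3 ^ (CARD('n) + 1) / rpeak t"
    unfolding rK_power_eq[OF t] using pos a by (simp add: field_simps power_divide)
  have "ennreal (enn2real (peak_sup t)) \<le> ennreal (2 * rpeak t)"
    using peak_sup_bounds(2)[OF t] a fin by (simp add: peak_rpeak[OF t] ennreal_mult)
  then have "enn2real (peak_sup t) \<le> 2 * rpeak t"
    using a by simp
  then show "1 / (2 * rpeak t) \<le> rK K t ^ CARD('n)"
    unfolding rK_power_eq[OF t] using pos a by (simp add: field_simps)
qed

text \<open>
  Since \<open>P\<^sub>t\<close> is bounded by a multiple of \<open>t ^ (- n)\<close>, ordinary cones stay within the volume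
  allowed by \<open>r\<^sub>K\<close> at every height.
\<close>
lemma power_le_rK_power:
  assumes t: "t > 0"
  shows "t ^ CARD('n) \<le> 2 * poisson_const TYPE('n) * mass * rK K t ^ CARD('n)"
proof -
  let ?c = "poisson_const TYPE('n)"
  have "?c / t ^ CARD('n) * mass \<ge> 0"
    using mass_nonneg poisson_const_pos[where 'n='n] t by simp
  then have "rpeak t \<le> ?c / t ^ CARD('n) * mass"
    using peak_le[OF t] by (simp add: peak_rpeak[OF t])
  then have "t ^ CARD('n) \<le> ?c * mass / rpeak t"
    using rpeak_pos[OF t] t by (simp add: field_simps)
  also have "\<dots> = 2 * ?c * mass * (1 / (2 * rpeak t))" by simp
  also have "\<dots> \<le> 2 * ?c * mass * rK K t ^ CARD('n)"
    using mass_nonneg poisson_const_pos[where 'n='n]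
    by (intro mult_left_mono rK_power_bounds t) auto
  finally show ?thesis .
qed

lemma rK_tends_to_zero:
  assumes "\<epsilon> > 0"
  shows "\<exists>\<delta>>0. \<forall>t. 0 < t \<longrightarrow> t \<le> \<delta> \<longrightarrow> rK K t \<le> \<epsilon>"
proof -
  define B where "B = 3 ^ (CARD('n) + 1) / \<epsilon> ^ CARD('n)"
  obtain \<delta> where \<delta>: "\<delta> > 0" "\<And>t. 0 < t \<Longrightarrow> t \<le> \<delta> \<Longrightarrow> ennreal B \<le> peak t"
    using peak_tends_to_infinity by blast
  have "rK K t \<le> \<epsilon>" if t: "0 < t" "t \<le> \<delta>" for t
  proof -
    have "B \<le> rpeak t"
      using \<delta>(2)[OF t] rpeak_pos[OF t(1)] by (simp add: peak_rpeak[OF t(1)])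
    then have "3 ^ (CARD('n) + 1) / rpeak t \<le> \<epsilon> ^ CARD('n)"
      using rpeak_pos[OF t(1)] assms by (simp add: B_def field_simps)
    then have "rK K t ^ CARD('n) \<le> \<epsilon> ^ CARD('n)"
      using rK_power_bounds(2)[OF t(1)] by linarith
    then show ?thesis using assms by (simp add: power_mono_iff rK_pos[OF t(1)] less_imp_le)
  qed
  then show ?thesis using \<delta>(1) by blast
qed

text \<open>
  Besides the decay of \<open>t ^ n * (P\<^sub>t * K)(0)\<close>, this makes the near parts of \<open>K\<close> summably small.
\<close>
lemma mass_near_zero_small:
  assumes "\<epsilon> > 0"
  shows "\<exists>\<delta>>0. (\<integral>\<^sup>+x. K x * indicator (cball 0 \<delta>) x \<partial>lborel) \<le> ennreal \<epsilon>"
proof -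
  let ?\<nu> = "density lborel K"
  let ?A = "\<lambda>m. cball (0 :: real ^ 'n) (1 / real (Suc m))"
  have "(\<Inter>m. ?A m) = {0}"
  proof (intro antisym subsetI)
    fix x assume x: "x \<in> (\<Inter>m. ?A m)"
    show "x \<in> {0}"
    proof (rule ccontr)
      assume "x \<notin> {0}"
      then obtain m where "inverse (real (Suc m)) < norm x"
        using reals_Archimedean[of "norm x"] by auto
      moreover have "norm x \<le> 1 / real (Suc m)" using x by auto
      ultimately show False by (simp add: inverse_eq_divide)
    qed
  qed auto
  moreover have "emeasure ?\<nu> {0} = 0"
  proof -
    have "emeasure ?\<nu> {0} = (\<integral>\<^sup>+x. K x * indicator {0} x \<partial>lborel)"
      by (rule emeasure_density) auto
    also have "\<dots> = 0"
      by (subst nn_integral_0_iff_AE)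
         (use AE_lborel_singleton[of "0 :: real ^ 'n"] in \<open>auto elim!: eventually_mono\<close>)
    finally show ?thesis .
  qed
  moreover have "(\<lambda>m. emeasure ?\<nu> (?A m)) \<longlonglongrightarrow> emeasure ?\<nu> (\<Inter>m. ?A m)"
  proof (rule Lim_emeasure_decseq)
    show "decseq ?A"
      by (intro decseq_SucI subset_cball) (simp add: field_simps)
    show "emeasure ?\<nu> (?A m) \<noteq> \<infinity>" for m
    proof -
      have "emeasure ?\<nu> (?A m) \<le> emeasure ?\<nu> UNIV" by (rule emeasure_mono) auto
      also have "\<dots> = ennreal mass" by (subst emeasure_density) (auto simp: mass)
      finally show ?thesis by (auto simp: top_unique)
    qed
  qed auto
  ultimately have "(\<lambda>m. emeasure ?\<nu> (?A m)) \<longlonglongrightarrow> 0" by simp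
  then have "eventually (\<lambda>m. emeasure ?\<nu> (?A m) < ennreal \<epsilon>) sequentially"
    by (rule order_tendstoD) (use assms in simp)
  then obtain m where "emeasure ?\<nu> (?A m) < ennreal \<epsilon>"
    unfolding eventually_sequentially by blast
  then show ?thesis
    by (intro exI[of _ "1 / real (Suc m)"]) (auto simp: emeasure_density intro!: less_imp_le)
qed

text \<open>
  By integrability \<open>t ^ n * P\<^sub>t * K (0) \<rightarrow> 0\<close> as \<open>t \<rightarrow> 0\<close>: the kernel \<open>t ^ n * P\<^sub>t\<close> is bounded, and
  tends to \<open>0\<close> uniformly away from the origin. So \<open>t = o(r\<^sub>K(t))\<close>.
\<close>
lemma power_small_rK_power:
  assumes \<epsilon>: "\<epsilon> > 0"
  shows "\<exists>\<delta>>0. \<forall>t. 0 < t \<longrightarrow> t \<le> \<delta> \<longrightarrow> t ^ CARD('n) \<le> \<epsilon> * rK K t ^ CARD('n)"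
proof -
  let ?c = "poisson_const TYPE('n)"
  have c: "?c > 0" by (rule poisson_const_pos)
  define \<eta> where "\<eta> = \<epsilon> / (4 * ?c)"
  have \<eta>: "\<eta> > 0" using \<epsilon> c by (simp add: \<eta>_def)
  obtain d where d: "d > 0" "(\<integral>\<^sup>+x. K x * indicator (cball 0 d) x \<partial>lborel) \<le> ennreal \<eta>"
    using mass_near_zero_small[OF \<eta>] by blast
  define \<delta> where "\<delta> = min d (d * \<eta> / (mass + 1))"
  have m: "mass + 1 > 0" using mass_nonneg by simp
  have \<delta>: "\<delta> > 0" using d \<eta> m by (simp add: \<delta>_def)
  have "t ^ CARD('n) \<le> \<epsilon> * rK K t ^ CARD('n)" if t: "0 < t" "t \<le> \<delta>" for t
  proof -
    let ?n = "CARD('n)"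
    have td: "t \<le> d" "t * (mass + 1) \<le> d * \<eta>"
      using t m by (auto simp: \<delta>_def field_simps)
    have "peak t \<le> (\<integral>\<^sup>+y. ennreal (?c / t ^ ?n) * (K y * indicator (cball 0 d) y)
                        + ennreal (?c * (t / d ^ (?n + 1))) * K y \<partial>lborel)"
      unfolding peak_eq
    proof (rule nn_integral_mono)
      fix y :: "real ^ 'n"
      show "epoisson t y * K y \<le> ennreal (?c / t ^ ?n) * (K y * indicator (cball 0 d) y)
                        + ennreal (?c * (t / d ^ (?n + 1))) * K y"
      proof (cases "norm y \<le> d")
        case True
        then show ?thesis
          using mult_right_mono[OF epoisson_le[OF t(1), of y], of "K y"]
          by (simp add: add_increasing2)
      next
        case False
        then have "epoisson t y * K y \<le> ennreal (?c * (t / d ^ (?n + 1))) * K y"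
          using t d by (intro mult_right_mono ennreal_leI poisson_le) auto
        then show ?thesis by (simp add: add_increasing)
      qed
    qed
    also have "\<dots> = ennreal (?c / t ^ ?n) * (\<integral>\<^sup>+y. K y * indicator (cball 0 d) y \<partial>lborel)
                 + ennreal (?c * (t / d ^ (?n + 1))) * ennreal mass"
      by (simp add: nn_integral_add nn_integral_cmult mass)
    also have "\<dots> \<le> ennreal (?c / t ^ ?n) * ennreal \<eta> + ennreal (?c * (t / d ^ (?n + 1))) * ennreal mass"
      by (intro add_mono mult_left_mono d(2)) auto
    also have "\<dots> = ennreal (?c / t ^ ?n * \<eta> + ?c * (t / d ^ (?n + 1)) * mass)"
    proof -
      have "ennreal a * ennreal \<eta> + ennreal b * ennreal mass = ennreal (a * \<eta> + b * mass)"
        if "a \<ge> 0" "b \<ge> 0" for a b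
        using that mass_nonneg \<eta> by (simp add: ennreal_mult)
      then show ?thesis using c t d by simp
    qed
    finally have "ennreal (rpeak t) \<le> ennreal (?c / t ^ ?n * \<eta> + ?c * (t / d ^ (?n + 1)) * mass)"
      unfolding peak_rpeak[OF t(1)] .
    then have "rpeak t \<le> ?c / t ^ ?n * \<eta> + ?c * (t / d ^ (?n + 1)) * mass"
      by (subst (asm) ennreal_le_iff) (use c t d mass_nonneg \<eta> in auto)
    then have "t ^ ?n * rpeak t \<le> t ^ ?n * (?c / t ^ ?n * \<eta> + ?c * (t / d ^ (?n + 1)) * mass)"
      using t by (intro mult_left_mono) auto
    also have "\<dots> = ?c * \<eta> + ?c * ((t / d) ^ ?n * (t * mass / d))"
      using t d by (simp add: field_simps)
    also have "\<dots> \<le> ?c * \<eta> + ?c * (1 * \<eta>)"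
      using t d c td mass_nonneg \<eta>
      by (intro add_mono mult_left_mono mult_mono power_le_one order_refl) (auto simp: field_simps)
    also have "\<dots> = \<epsilon> / 2" using c by (simp add: \<eta>_def)
    finally have "t ^ ?n \<le> \<epsilon> * (1 / (2 * rpeak t))"
      using rpeak_pos[OF t(1)] by (simp add: field_simps)
    also have "\<dots> \<le> \<epsilon> * rK K t ^ ?n"
      using \<epsilon> by (intro mult_left_mono rK_power_bounds t) auto
    finally show ?thesis .
  qed
  then show ?thesis using \<delta> by blast
qed

end

section \<open>A sparse union of cones\<close>

definition unit_vector :: "'a::euclidean_space" where
  "unit_vector = (SOME e. norm e = 1)"

lemma norm_unit_vector: "norm (unit_vector :: 'a::euclidean_space) = 1"
proof -
  obtain e :: 'a where "norm e = 1" by (rule vector_choose_size[of 1]) auto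
  then show ?thesis unfolding unit_vector_def by (rule someI)
qed

text \<open>
  The parameters of the \<open>k\<close>-th group of cones: \<open>\<delta> k\<close> bounds the distance of the vertices from
  the origin, \<open>\<tau> k\<close> is their height, and \<open>T k\<close> is the height at which the completed region will be seen to be
  too large. Here \<open>thin\<close> yields the volume bound, \<open>light\<close> the weak type inequality, and the last two
  assumptions the failure of both for the completed region.
\<close>
locale sparse_cones = radial_kernel K for K :: "real ^ 'n::finite \<Rightarrow> ennreal" +
  fixes \<delta> \<tau> T :: "nat \<Rightarrow> real"
  assumes \<delta>_pos: "\<delta> k > 0" and \<tau>_pos: "\<tau> k > 0" and T_pos: "T k > 0"
    and thin: "0 < t \<Longrightarrow> t \<le> \<delta> k \<Longrightarrow> real k * t ^ CARD('n) \<le> (1/2) ^ k * rK K t ^ CARD('n)"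
    and light: "ennreal (real k) * (\<integral>\<^sup>+x. K x * indicator (cball 0 (\<delta> k)) x \<partial>lborel) \<le> ennreal ((1/2) ^ k)"
    and separated: "rK K (T k) \<le> \<delta> k / (real k + 1)"
    and deep: "rK K (2 * \<tau> k) \<le> rK K (T k) / 2"
begin

definition vertex :: "nat \<Rightarrow> nat \<Rightarrow> real ^ 'n" where
  "vertex k i = (\<delta> k * (real i + 1) / (real k + 1)) *\<^sub>R unit_vector"

lemma norm_vertex_le: "i < k \<Longrightarrow> norm (vertex k i) \<le> \<delta> k"
  using \<delta>_pos[of k] by (simp add: vertex_def norm_unit_vector field_simps)

lemma vertex_separated:
  assumes "i \<noteq> j"
  shows "\<delta> k / (real k + 1) \<le> norm (vertex k i - vertex k j)"
proof -
  have "vertex k i - vertex k j = (\<delta> k / (real k + 1) * (real i - real j)) *\<^sub>R unit_vector"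
    unfolding vertex_def scaleR_left_diff_distrib[symmetric]
    by (rule arg_cong[where f="\<lambda>c. c *\<^sub>R _"]) (simp only: diff_divide_distrib[symmetric] times_divide_eq_left, simp add: algebra_simps)
  then have "norm (vertex k i - vertex k j) = \<delta> k / (real k + 1) * \<bar>real i - real j\<bar>"
    using \<delta>_pos[of k] by (simp add: norm_unit_vector abs_mult)
  moreover have "\<bar>real i - real j\<bar> \<ge> 1" using assms by linarith
  ultimately show ?thesis
    using \<delta>_pos[of k] mult_left_mono[of 1 "\<bar>real i - real j\<bar>" "\<delta> k / (real k + 1)"] by simp
qed

text \<open>
  The cones are open, so that all sections of the region, of its completion and the superlevel
  sets of both maximal functions are open, hence measurable.
\<close>
definition region :: "((real ^ 'n) \<times> real) set" where
  "region = {(y, s). norm y < s \<or> (\<exists>k. \<exists>i<k. norm (y - vertex k i) < s - \<tau> k)}"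

lemma region_subset: "region \<subseteq> half_space"
proof -
  have "s > 0" if "norm (y - vertex k i) < s - \<tau> k" for y s k i
    using that \<tau>_pos[of k] norm_ge_zero[of "y - vertex k i"] by linarith
  moreover have "s > 0" if "norm y < s" for y :: "real ^ 'n" and s
    using that norm_ge_zero[of y] by linarith
  ultimately show ?thesis unfolding region_def half_space_def by blast
qed

lemma region_cone: "cone_condition region"
  unfolding cone_condition_def
proof safe
  fix x y :: "real ^ 'n" and t s :: real
  assume xt: "(x, t) \<in> region" and xy: "norm (x - y) \<le> s - t"
  have tri: "norm (y - v) < s - c" if "norm (x - v) < t - c" for v c
    using that xy norm_triangle_ineq[of "y - x" "x - v"] by (simp add: norm_minus_commute)
  show "(y, s) \<in> region"
    using xt tri[of 0 0] tri unfolding region_def by fastforce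
qed

lemma cross_section_region:
  "cross_section region t = ball 0 t \<union> (\<Union>k. \<Union>i\<in>{..<k}. ball (vertex k i) (t - \<tau> k))"
  by (auto simp: cross_section_def region_def dist_norm norm_minus_commute)

lemma open_cross_section_region: "open (cross_section region t)"
  unfolding cross_section_region by auto

lemma emeasure_cross_section_region:
  assumes t: "t > 0"
  shows "emeasure lborel (cross_section region t)
     \<le> ennreal (unit_ball_vol (real CARD('n)) * (2 ^ CARD('n) * (2 * poisson_const TYPE('n) * mass) + 2)
                * rK K t ^ CARD('n))"
proof -
  let ?V = "unit_ball_vol (real CARD('n))" and ?n = "CARD('n)"
  let ?c0 = "2 * poisson_const TYPE('n) * mass"
  let ?R = "rK K t ^ ?n"
  have R: "?R > 0" using rK_pos[OF t] by simp
  define U where "U k = (if t \<le> \<delta> k then \<Union>i\<in>{..<k}. ball (vertex k i) t else {})" for k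
  have U: "U k \<in> sets borel" for k by (auto simp: U_def)
  have "cross_section region t \<subseteq> ball 0 (2 * t) \<union> (\<Union>k. U k)"
  proof
    fix y assume "y \<in> cross_section region t"
    then consider "norm y < t" | k i where "i < k" "norm (y - vertex k i) < t - \<tau> k"
      by (auto simp: cross_section_def region_def)
    then show "y \<in> ball 0 (2 * t) \<union> (\<Union>k. U k)"
    proof cases
      case 1
      then show ?thesis using t by simp
    next
      case 2
      then have *: "norm (y - vertex k i) < t" using \<tau>_pos[of k] by linarith
      show ?thesis
      proof (cases "t \<le> \<delta> k")
        case True
        then have "y \<in> U k"
          using * 2(1) by (auto simp: U_def dist_norm norm_minus_commute)
        then show ?thesis by blast
      next
        case False
        then have "norm y < 2 * t"
          using * norm_vertex_le[OF 2(1)] norm_triangle_sub[of y "vertex k i"] by linarith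
        then show ?thesis by simp
      qed
    qed
  qed
  then have "emeasure lborel (cross_section region t) \<le> emeasure lborel (ball 0 (2 * t) \<union> (\<Union>k. U k))"
    using U by (intro emeasure_mono) auto
  also have "\<dots> \<le> emeasure lborel (ball (0 :: real ^ 'n) (2 * t)) + emeasure lborel (\<Union>k. U k)"
    using U by (intro emeasure_subadditive) auto
  also have "emeasure lborel (\<Union>k. U k) \<le> (\<Sum>k. emeasure lborel (U k))"
    using U by (intro emeasure_subadditive_countably) auto
  also have "(\<Sum>k. emeasure lborel (U k)) \<le> (\<Sum>k. ennreal (?V * ?R * (1/2) ^ k))"
  proof (rule suminf_le)
    fix k
    show "emeasure lborel (U k) \<le> ennreal (?V * ?R * (1/2) ^ k)"
    proof (cases "t \<le> \<delta> k")
      case True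
      have "emeasure lborel (U k) \<le> (\<Sum>i\<in>{..<k}. emeasure lborel (ball (vertex k i) t))"
        unfolding U_def using True by (simp, intro emeasure_subadditive_finite) auto
      also have "\<dots> = ennreal (real k * (?V * t ^ ?n))"
        using t by (simp add: emeasure_ball ennreal_of_nat_eq_real_of_nat ennreal_mult)
      also have "\<dots> \<le> ennreal (?V * ?R * (1/2) ^ k)"
        using mult_left_mono[OF thin[OF t True], of ?V] by (intro ennreal_leI) (simp add: mult_ac)
      finally show ?thesis .
    qed (simp add: U_def)
  qed auto
  also have "\<dots> = ennreal (2 * (?V * ?R))"
    using R by (intro suminf_half_powers) auto
  also have "emeasure lborel (ball (0 :: real ^ 'n) (2 * t)) = ennreal (?V * (2 ^ ?n * t ^ ?n))"
    using t by (simp add: emeasure_ball power_mult_distrib)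
  also have "\<dots> \<le> ennreal (?V * (2 ^ ?n * (?c0 * ?R)))"
    by (intro ennreal_leI mult_left_mono power_le_rK_power t) auto
  also have "ennreal (?V * (2 ^ ?n * (?c0 * ?R))) + ennreal (2 * (?V * ?R))
      = ennreal (?V * (2 ^ ?n * (?c0 * ?R)) + 2 * (?V * ?R))"
    using R mass_nonneg poisson_const_pos[where 'n='n] by (intro ennreal_plus[symmetric]) auto
  also have "?V * (2 ^ ?n * (?c0 * ?R)) + 2 * (?V * ?R) = ?V * (2 ^ ?n * ?c0 + 2) * ?R"
    by (simp add: algebra_simps)
  finally show ?thesis by (simp add: add_mono)
qed

section \<open>The maximal function of the sparse region\<close>

definition stretched :: "real ^ 'n \<Rightarrow> ennreal" where "stretched z = K (z /\<^sub>R 2)"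
definition near :: "nat \<Rightarrow> real ^ 'n \<Rightarrow> ennreal" where "near k z = K z * indicator (cball 0 (\<delta> k)) z"
definition far :: "nat \<Rightarrow> real ^ 'n \<Rightarrow> ennreal" where "far k z = K z * indicator (- cball 0 (\<delta> k)) z"

lemma kernel_parts_measurable [measurable]:
  "stretched \<in> borel_measurable borel" "near k \<in> borel_measurable borel" "far k \<in> borel_measurable borel"
proof -
  have [measurable]: "- cball 0 (\<delta> k) \<in> sets (borel :: (real ^ 'n) measure)" by simp
  show "stretched \<in> borel_measurable borel" "near k \<in> borel_measurable borel" "far k \<in> borel_measurable borel"
    unfolding stretched_def[abs_def] near_def[abs_def] far_def[abs_def] by measurable
qed

lemma near_plus_far: "near k z + far k z = K z"
  by (auto simp: near_def far_def indicator_def)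

lemma K_le_stretched: "K z \<le> stretched z"
  unfolding stretched_def by (rule K_decreasing) simp

lemma far_translate_le:
  assumes "norm v \<le> \<delta> k"
  shows "far k (z + v) \<le> stretched z"
proof (cases "norm (z + v) \<le> \<delta> k")
  case False
  have "norm z \<le> norm (z + v) + norm v"
    using norm_triangle_ineq4[of "z + v" v] by simp
  then have "K (z + v) \<le> K (z /\<^sub>R 2)"
    using False assms by (intro K_decreasing) simp
  then show ?thesis using False by (simp add: far_def stretched_def)
qed (simp add: far_def)

lemma nn_integral_stretched: "(\<integral>\<^sup>+z. stretched z \<partial>lborel) = ennreal (2 ^ CARD('n) * mass)"
  using nn_integral_lborel_affine[of stretched 2 0] kernel_parts_measurable(1) mass_nonneg
  by (simp add: stretched_def mass ennreal_mult)

text \<open>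
  Split \<open>K\<close> at the scale \<open>\<delta> k\<close> on which the \<open>k\<close>-th group of vertices lives. The far part does not
  notice a translation by a vertex, up to a dilation of \<open>K\<close>; the near part does, but its
  mass is so small that the \<open>k\<close> translated superlevel sets can simply be added up.
\<close>
lemma region_superlevel_subset:
  fixes F :: "real ^ 'n \<Rightarrow> ennreal"
  assumes [measurable]: "F \<in> borel_measurable borel" and \<alpha>: "\<alpha> > 0"
    and ys: "(y, s) \<in> shift_region x region"
    and big: "econv (epoisson s) (econv K F) y > ennreal \<alpha>"
  shows "x \<in> nt_superlevel (econv stretched F) (\<alpha>/2) \<or>
     (\<exists>k. \<exists>i<k. x + vertex k i \<in> nt_superlevel (econv (near k) F) (\<alpha>/2))"
proof -
  obtain v where v: "y = x + v" "(v, s) \<in> region"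
    using ys by (auto simp: shift_region_def)
  have s: "s > 0" using v(2) region_subset by (auto simp: half_space_def)
  have half: "ennreal (\<alpha>/2) < ennreal \<alpha>" using \<alpha> by (simp add: ennreal_less_iff)
  have wide: "x \<in> nt_superlevel (econv stretched F) (\<alpha>/2)" if "norm v < 2 * s"
  proof -
    have "ennreal (\<alpha>/2) < econv (epoisson s) (econv K F) y"
      using half big by order
    also have "\<dots> \<le> econv (epoisson s) (econv stretched F) y"
      by (intro econv_mono K_le_stretched) auto
    finally show ?thesis using that s v(1) by (auto simp: nt_superlevel_def intro!: exI[of _ y] exI[of _ s])
  qed
  consider "norm v < s" | k i where "i < k" "norm (v - vertex k i) < s - \<tau> k"
    using v(2) by (auto simp: region_def)
  then show ?thesis
  proof cases
    case 1
    then show ?thesis using wide s by simp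
  next
    case 2
    (* Above height \<delta> k the displacement by the vertex is absorbed by the aperture; below it the
       kernel is split. *)
    let ?v = "vertex k i"
    have vs: "norm (v - ?v) < s" using 2(2) \<tau>_pos[of k] by linarith
    show ?thesis
    proof (cases "s \<le> \<delta> k")
      case False
      then have "norm v < 2 * s"
        using vs norm_vertex_le[OF 2(1)] norm_triangle_sub[of v ?v] by linarith
      then show ?thesis using wide by simp
    next
      case True
      have "econv (epoisson s) (econv K F) y
          = econv (epoisson s) (\<lambda>z. econv (near k) F z + econv (far k) F z) y"
        by (subst econv_add_left[symmetric]) (simp_all add: near_plus_far)
      also have "\<dots> = econv (epoisson s) (econv (near k) F) y + econv (epoisson s) (econv (far k) F) y"
        by (rule econv_add_right) measurable
      finally have sum: "econv (epoisson s) (econv K F) y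
          = econv (epoisson s) (econv (near k) F) y + econv (epoisson s) (econv (far k) F) y" .
      have "econv (epoisson s) (econv (near k) F) y > ennreal (\<alpha>/2)
          \<or> econv (epoisson s) (econv (far k) F) y > ennreal (\<alpha>/2)"
      proof (rule ccontr)
        assume "\<not> ?thesis"
        then have "econv (epoisson s) (econv K F) y \<le> ennreal (\<alpha>/2) + ennreal (\<alpha>/2)"
          unfolding sum by (intro add_mono) auto
        also have "\<dots> = ennreal \<alpha>" using \<alpha> by (simp add: ennreal_plus[symmetric])
        finally show False using big by simp
      qed
      then show ?thesis
      proof
        assume "econv (epoisson s) (econv (near k) F) y > ennreal (\<alpha>/2)"
        moreover have "norm (y - (x + ?v)) < 2 * s" using vs s v(1) by simp
        ultimately have "x + ?v \<in> nt_superlevel (econv (near k) F) (\<alpha>/2)"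
          using s by (auto simp: nt_superlevel_def)
        then show ?thesis using 2(1) by blast
      next
        assume "econv (epoisson s) (econv (far k) F) y > ennreal (\<alpha>/2)"
        also have "econv (epoisson s) (econv (far k) F) y
            = econv (epoisson s) (\<lambda>z. econv (far k) F (z + ?v)) (y - ?v)"
          using econv_translate[of "epoisson s" "econv (far k) F" "y - ?v" ?v] by simp
        also have "\<dots> \<le> econv (epoisson s) (econv stretched F) (y - ?v)"
        proof (rule econv_mono)
          fix z
          have "far k (z + ?v - w) \<le> stretched (z - w)" for w
            using far_translate_le[OF norm_vertex_le[OF 2(1)], of "z - w"] by (simp add: algebra_simps)
          then show "econv (far k) F (z + ?v) \<le> econv stretched F z"
            unfolding econv_def by (intro nn_integral_mono mult_right_mono) auto
        qed simp
        finally have "econv (epoisson s) (econv stretched F) (y - ?v) > ennreal (\<alpha>/2)" .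
        moreover have "norm (y - ?v - x) < 2 * s" using vs s v(1) by (simp add: algebra_simps)
        ultimately have "x \<in> nt_superlevel (econv stretched F) (\<alpha>/2)"
          using s by (auto simp: nt_superlevel_def)
        then show ?thesis ..
      qed
    qed
  qed
qed

definition weak_const :: real where
  "weak_const = 2 * nt_const TYPE('n) * (2 ^ CARD('n) * mass + 2)"

lemma weak_const_nonneg: "weak_const \<ge> 0"
  using nt_const_nonneg[where 'n='n] mass_nonneg by (simp add: weak_const_def)

lemma region_superlevel_measure:
  fixes F :: "real ^ 'n \<Rightarrow> ennreal"
  assumes [measurable]: "F \<in> borel_measurable borel" and \<alpha>: "\<alpha> > 0"
    and F: "(\<integral>\<^sup>+x. F x \<partial>lborel) = ennreal \<phi>" and \<phi>: "\<phi> \<ge> 0"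
    and S: "\<And>x. x \<in> S \<Longrightarrow> \<exists>(y, s)\<in>shift_region x region. econv (epoisson s) (econv K F) y > ennreal \<alpha>"
  shows "emeasure lborel S \<le> ennreal (weak_const * \<phi> / \<alpha>)"
proof -
  let ?N = "nt_superlevel (econv stretched F) (\<alpha>/2)"
  let ?A = "\<lambda>k. nt_superlevel (econv (near k) F) (\<alpha>/2)"
  let ?D = "nt_const TYPE('n) / (\<alpha>/2)"
  have D: "?D \<ge> 0" using nt_const_nonneg[where 'n='n] \<alpha> by simp
  define U where "U k = (\<Union>i\<in>{..<k}. {x. x + vertex k i \<in> ?A k})" for k
  have bor [measurable]: "?N \<in> sets borel" "?A k \<in> sets borel" for k
    by (simp_all add: open_nt_superlevel)
  have shift: "{x. x + vertex k i \<in> ?A k} \<in> sets borel" for k i by measurable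
  then have U: "U k \<in> sets borel" for k by (auto simp: U_def)
  have "S \<subseteq> ?N \<union> (\<Union>k. U k)"
  proof
    fix x assume "x \<in> S"
    then obtain y s where "(y, s) \<in> shift_region x region"
      "econv (epoisson s) (econv K F) y > ennreal \<alpha>" using S by blast
    from region_superlevel_subset[OF assms(1) \<alpha> this]
    show "x \<in> ?N \<union> (\<Union>k. U k)" by (auto simp: U_def)
  qed
  then have "emeasure lborel S \<le> emeasure lborel (?N \<union> (\<Union>k. U k))"
    using U bor by (intro emeasure_mono) auto
  also have "\<dots> \<le> emeasure lborel ?N + emeasure lborel (\<Union>k. U k)"
    using U bor by (intro emeasure_subadditive) auto
  also have "emeasure lborel (\<Union>k. U k) \<le> (\<Sum>k. emeasure lborel (U k))"
    using U by (intro emeasure_subadditive_countably) auto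
  also have "(\<Sum>k. emeasure lborel (U k)) \<le> (\<Sum>k. ennreal (?D * \<phi> * (1/2) ^ k))"
  proof (rule suminf_le)
    fix k
    have near_int: "(\<integral>\<^sup>+x. econv (near k) F x \<partial>lborel)
        = (\<integral>\<^sup>+x. K x * indicator (cball 0 (\<delta> k)) x \<partial>lborel) * ennreal \<phi>"
    proof -
      have "(\<integral>\<^sup>+x. near k x \<partial>lborel) = (\<integral>\<^sup>+x. K x * indicator (cball 0 (\<delta> k)) x \<partial>lborel)"
        by (simp add: near_def)
      then show ?thesis by (subst nn_integral_econv) (simp_all add: F)
    qed
    have "(\<integral>\<^sup>+x. near k x \<partial>lborel) \<le> (\<integral>\<^sup>+x. K x \<partial>lborel)"
      by (rule nn_integral_mono) (auto simp: near_def indicator_def)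
    then have "(\<integral>\<^sup>+x. near k x \<partial>lborel) < \<infinity>"
      by (simp add: mass le_less_trans)
    then have "(\<integral>\<^sup>+x. econv (near k) F x \<partial>lborel) < \<infinity>"
      by (simp add: nn_integral_econv F ennreal_mult_less_top)
    then have A: "emeasure lborel (?A k) \<le> ennreal ?D * (\<integral>\<^sup>+x. econv (near k) F x \<partial>lborel)"
      using \<alpha> by (intro nt_superlevel_weak_type) auto
    have "emeasure lborel (U k) \<le> (\<Sum>i\<in>{..<k}. emeasure lborel {x. x + vertex k i \<in> ?A k})"
      unfolding U_def using shift by (intro emeasure_subadditive_finite) auto
    also have "\<dots> = ennreal (real k) * emeasure lborel (?A k)"
      by (simp add: emeasure_translate bor ennreal_of_nat_eq_real_of_nat)
    also have "\<dots> \<le> ennreal (real k) * (ennreal ?D * (\<integral>\<^sup>+x. econv (near k) F x \<partial>lborel))"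
      by (intro mult_left_mono A) auto
    also have "\<dots> = ennreal (?D * \<phi>)
        * (ennreal (real k) * (\<integral>\<^sup>+x. K x * indicator (cball 0 (\<delta> k)) x \<partial>lborel))"
      unfolding near_int ennreal_mult[OF D \<phi>] by (simp only: mult_ac)
    also have "\<dots> \<le> ennreal (?D * \<phi>) * ennreal ((1/2) ^ k)"
      by (intro mult_left_mono light) auto
    also have "\<dots> = ennreal (?D * \<phi> * (1/2) ^ k)"
      by (intro ennreal_mult[symmetric] mult_nonneg_nonneg D \<phi>) simp
    finally show "emeasure lborel (U k) \<le> ennreal (?D * \<phi> * (1/2) ^ k)" .
  qed auto
  also have "\<dots> = ennreal (2 * (?D * \<phi>))"
    by (intro suminf_half_powers mult_nonneg_nonneg D \<phi>)
  also have "emeasure lborel ?N \<le> ennreal ?D * (ennreal (2 ^ CARD('n) * mass) * ennreal \<phi>)"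
  proof -
    have "(\<integral>\<^sup>+x. econv stretched F x \<partial>lborel) = ennreal (2 ^ CARD('n) * mass) * ennreal \<phi>"
      by (simp add: nn_integral_econv nn_integral_stretched F)
    moreover from this have "emeasure lborel ?N \<le> ennreal ?D * (\<integral>\<^sup>+x. econv stretched F x \<partial>lborel)"
      using \<alpha> by (intro nt_superlevel_weak_type) (auto simp: ennreal_mult_less_top)
    ultimately show ?thesis by simp
  qed
  also have "ennreal ?D * (ennreal (2 ^ CARD('n) * mass) * ennreal \<phi>) = ennreal (?D * (2 ^ CARD('n) * mass * \<phi>))"
    using mass_nonneg
    by (simp only: ennreal_mult[OF D, symmetric] ennreal_mult[symmetric] \<phi> mult_nonneg_nonneg
        zero_le_power zero_le_numeral)
  also have "ennreal (?D * (2 ^ CARD('n) * mass * \<phi>)) + ennreal (2 * (?D * \<phi>))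
      = ennreal (?D * (2 ^ CARD('n) * mass * \<phi>) + 2 * (?D * \<phi>))"
    using mass_nonneg by (intro ennreal_plus[symmetric] mult_nonneg_nonneg D \<phi>) auto
  also have "?D * (2 ^ CARD('n) * mass * \<phi>) + 2 * (?D * \<phi>) = weak_const * \<phi> / \<alpha>"
    using \<alpha> by (simp add: weak_const_def field_simps)
  finally show ?thesis by (simp add: add_mono)
qed

end

section \<open>Potentials\<close>

context radial_kernel
begin

lemma represents_dominated:
  assumes "represents K F f"
  obtains G where "G \<in> borel_measurable borel" "(\<integral>\<^sup>+x. G x \<partial>lborel) = ennreal (\<integral>x. \<bar>F x\<bar> \<partial>lebesgue)"
    "AE z in lebesgue. ennreal \<bar>f z\<bar> \<le> econv K G z"
proof -
  have F: "integrable lebesgue F" and f: "AE x in lebesgue. f x = kconv K F x"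
    using assms by (auto simp: represents_def)
  obtain F1 where F1 [measurable]: "F1 \<in> borel_measurable lborel" and eq: "AE x in lborel. F x = F1 x"
    using completion_ex_borel_measurable_real[of F lborel] borel_measurable_integrable[OF F] by blast
  define G where "G x = ennreal \<bar>F1 x\<bar>" for x
  have eq': "AE x in lebesgue. ennreal \<bar>F x\<bar> = G x"
    using AE_completion[OF eq] by (auto simp: G_def)
  have [measurable]: "G \<in> borel_measurable borel"
    unfolding G_def[abs_def] using F1 by simp
  moreover have "(\<integral>\<^sup>+x. G x \<partial>lborel) = ennreal (\<integral>x. \<bar>F x\<bar> \<partial>lebesgue)"
  proof -
    have "ennreal (\<integral>x. \<bar>F x\<bar> \<partial>lebesgue) = (\<integral>\<^sup>+x. ennreal \<bar>F x\<bar> \<partial>lebesgue)"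
      using F by (intro nn_integral_eq_integral[symmetric]) auto
    also have "\<dots> = (\<integral>\<^sup>+x. G x \<partial>lebesgue)"
      by (rule nn_integral_cong_AE) (rule eq')
    finally show ?thesis by (simp add: nn_integral_completion)
  qed
  moreover have "AE z in lebesgue. ennreal \<bar>f z\<bar> \<le> econv K G z"
    using f
  proof (rule eventually_mono)
    fix z assume "f z = kconv K F z"
    then have "ennreal \<bar>f z\<bar> = ennreal \<bar>conv finite_part F z\<bar>"
      by (simp add: kconv_def finite_part_def[abs_def])
    also have "\<dots> \<le> econv (\<lambda>x. ennreal (finite_part x)) G z"
      by (rule abs_conv_le_econv) (use eq' in \<open>auto simp: finite_part_nonneg\<close>)
    also have "\<dots> \<le> econv K G z"
      by (intro econv_mono finite_part_le) auto
    finally show "ennreal \<bar>f z\<bar> \<le> econv K G z" .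
  qed
  ultimately show thesis by (rule that)
qed

lemma potential_norm_nonneg: "f \<in> potential_space K \<Longrightarrow> potential_norm K f \<ge> 0"
  unfolding potential_norm_def potential_space_def by (intro cInf_greatest) auto

lemma potential_norm_le: "represents K F f \<Longrightarrow> potential_norm K f \<le> (\<integral>x. \<bar>F x\<bar> \<partial>lebesgue)"
  unfolding potential_norm_def by (intro cInf_lower bdd_belowI[of _ 0]) auto

text \<open>
  The parameters are chosen in the order \<open>\<delta> k\<close>, \<open>T k\<close>, \<open>\<tau> k\<close>, each small enough in terms of the
  preceding ones.
\<close>
lemma parameters_exist: "\<exists>\<delta> \<tau> T. sparse_cones K \<delta> \<tau> T"
proof -
  define P where "P k d u r \<longleftrightarrow> d > 0 \<and> u > 0 \<and> r > 0
      \<and> (\<forall>t. 0 < t \<longrightarrow> t \<le> d \<longrightarrow> real k * t ^ CARD('n) \<le> (1/2) ^ k * rK K t ^ CARD('n))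
      \<and> ennreal (real k) * (\<integral>\<^sup>+x. K x * indicator (cball 0 d) x \<partial>lborel) \<le> ennreal ((1/2) ^ k)
      \<and> rK K r \<le> d / (real k + 1) \<and> rK K (2 * u) \<le> rK K r / 2" for k :: nat and d u r
  have "\<exists>d u r. P k d u r" for k
  proof -
    \<comment> \<open>the \<open>+ 1\<close> only avoids a division by \<open>0\<close> for \<open>k = 0\<close>\<close>
    define \<epsilon> where "\<epsilon> = (1/2) ^ k / (real k + 1)"
    have \<epsilon>: "\<epsilon> > 0" by (simp add: \<epsilon>_def)
    have k\<epsilon>: "real k * \<epsilon> \<le> (1/2) ^ k"
    proof -
      have "real k * \<epsilon> = (1/2) ^ k * (real k / (real k + 1))"
        by (simp only: \<epsilon>_def times_divide_eq_right mult.commute)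
      also have "\<dots> \<le> (1/2) ^ k * 1" by (rule mult_left_mono) auto
      finally show ?thesis by simp
    qed
    obtain d1 where d1: "d1 > 0" "\<And>t. 0 < t \<Longrightarrow> t \<le> d1 \<Longrightarrow> t ^ CARD('n) \<le> \<epsilon> * rK K t ^ CARD('n)"
      using power_small_rK_power[OF \<epsilon>] by blast
    obtain d2 where d2: "d2 > 0" "(\<integral>\<^sup>+x. K x * indicator (cball 0 d2) x \<partial>lborel) \<le> ennreal \<epsilon>"
      using mass_near_zero_small[OF \<epsilon>] by blast
    define d where "d = min d1 d2"
    have d: "d > 0" using d1 d2 by (simp add: d_def)
    have thin: "real k * t ^ CARD('n) \<le> (1/2) ^ k * rK K t ^ CARD('n)" if t: "0 < t" "t \<le> d" for t
    proof -
      have "real k * t ^ CARD('n) \<le> real k * (\<epsilon> * rK K t ^ CARD('n))"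
        using d1(2)[of t] t by (intro mult_left_mono) (auto simp: d_def)
      also have "\<dots> = (real k * \<epsilon>) * rK K t ^ CARD('n)" by simp
      also have "\<dots> \<le> (1/2) ^ k * rK K t ^ CARD('n)"
        using k\<epsilon> rK_pos[OF t(1)] by (intro mult_right_mono) auto
      finally show ?thesis .
    qed
    have "(\<integral>\<^sup>+x. K x * indicator (cball 0 d) x \<partial>lborel) \<le> (\<integral>\<^sup>+x. K x * indicator (cball 0 d2) x \<partial>lborel)"
      by (rule nn_integral_mono) (auto simp: indicator_def d_def)
    then have "ennreal (real k) * (\<integral>\<^sup>+x. K x * indicator (cball 0 d) x \<partial>lborel) \<le> ennreal (real k) * ennreal \<epsilon>"
      using d2(2) by (intro mult_left_mono) auto
    also have "\<dots> = ennreal (real k * \<epsilon>)" using \<epsilon> by (simp add: ennreal_mult)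
    also have "\<dots> \<le> ennreal ((1/2) ^ k)" by (rule ennreal_leI) (rule k\<epsilon>)
    finally have light: "ennreal (real k) * (\<integral>\<^sup>+x. K x * indicator (cball 0 d) x \<partial>lborel) \<le> ennreal ((1/2) ^ k)" .
    obtain r where r: "r > 0" "rK K r \<le> d / (real k + 1)"
      using rK_tends_to_zero[of "d / (real k + 1)"] d by auto
    obtain w where w: "w > 0" "rK K w \<le> rK K r / 2"
      using rK_tends_to_zero[of "rK K r / 2"] rK_pos[OF r(1)] by auto
    show ?thesis
      unfolding P_def using d r w thin light by (intro exI[of _ d] exI[of _ "w/2"] exI[of _ r]) auto
  qed
  then obtain \<delta> \<tau> T where "P k (\<delta> k) (\<tau> k) (T k)" for k by metis
  then have "sparse_cones K \<delta> \<tau> T" unfolding P_def by unfold_locales blast+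
  then show ?thesis by blast
qed

text \<open>
  Testing on the potential of a ball of radius \<open>t\<close>: at height \<open>t\<close> its Poisson integral over the
  origin is comparable with the peak value times the volume of the ball, by Harnack.
\<close>
lemma ball_potential:
  assumes t: "t > 0"
  defines "F \<equiv> indicator (cball 0 t) :: real ^ 'n \<Rightarrow> real"
  shows "represents K F (kconv K F)"
    and "(\<integral>x. \<bar>F x\<bar> \<partial>lebesgue) = unit_ball_vol (real CARD('n)) * t ^ CARD('n)"
    and "(1/3) ^ (CARD('n) + 1) * rpeak t * (unit_ball_vol (real CARD('n)) * t ^ CARD('n))
           \<le> \<bar>conv (poisson t) (kconv K F) 0\<bar>"
proof -
  let ?W = "unit_ball_vol (real CARD('n)) * t ^ CARD('n)"
  let ?\<kappa> = "(1/3) ^ (CARD('n) + 1) :: real"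
  have vol: "emeasure lborel (cball (0 :: real ^ 'n) t) = ennreal ?W"
    using t by (simp add: emeasure_cball)
  have F [measurable]: "F \<in> borel_measurable borel" and F0: "F x \<ge> 0" for x
    by (auto simp: F_def)
  have Fint: "(\<integral>\<^sup>+x. ennreal (F x) \<partial>lborel) = ennreal ?W"
  proof -
    have "(\<integral>\<^sup>+x. ennreal (F x) \<partial>lborel) = (\<integral>\<^sup>+x. indicator (cball (0 :: real ^ 'n) t) x \<partial>lborel)"
      by (rule nn_integral_cong) (simp add: F_def indicator_def)
    then show ?thesis by (simp add: vol)
  qed
  have Fm: "F \<in> borel_measurable lebesgue"
    using F by (intro measurable_completion) simp
  have "integrable lebesgue F"
    using Fm Fint F0 by (intro integrableI_nonneg) (auto simp: nn_integral_completion)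
  then show "represents K F (kconv K F)" by (simp add: represents_def)
  have "(\<integral>x. \<bar>F x\<bar> \<partial>lebesgue) = (\<integral>x. F x \<partial>lebesgue)" by (simp add: F0)
  also have "\<dots> = enn2real (\<integral>\<^sup>+x. ennreal (F x) \<partial>lebesgue)"
    using Fm F0 by (intro integral_eq_nn_integral) auto
  also have "\<dots> = ?W" using t by (simp add: nn_integral_completion Fint)
  finally show "(\<integral>x. \<bar>F x\<bar> \<partial>lebesgue) = ?W" .
  let ?k = "\<lambda>x. ennreal (finite_part x)" and ?F = "\<lambda>x. ennreal (F x)"
  have f: "kconv K F z = enn2real (econv ?k ?F z)" for z
    unfolding kconv_def finite_part_def[symmetric]
    by (rule conv_eq_econv) (auto simp: finite_part_nonneg F0)
  have "(\<integral>\<^sup>+z. econv ?k ?F z \<partial>lborel) = (\<integral>\<^sup>+z. K z \<partial>lborel) * ennreal ?W"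
    by (simp add: nn_integral_econv Fint nn_integral_cong_AE[OF finite_part_AE])
  then have "(\<integral>\<^sup>+z. econv ?k ?F z \<partial>lborel) \<noteq> \<infinity>"
    by (simp add: mass ennreal_mult_eq_top_iff)
  then have "AE z in lborel. econv ?k ?F z \<noteq> \<infinity>"
    by (intro nn_integral_PInf_AE) auto
  then have AE: "AE z in lborel. ennreal (kconv K F z) = econv ?k ?F z"
    by (rule eventually_mono) (simp add: f less_top)
  have [measurable]: "kconv K F \<in> borel_measurable borel"
    unfolding f[abs_def] by measurable
  have "conv (poisson t) (kconv K F) 0 = enn2real (econv (epoisson t) (\<lambda>z. ennreal (kconv K F z)) 0)"
    by (rule conv_eq_econv) (auto simp: poisson_nonneg[OF t] f)
  also have "econv (epoisson t) (\<lambda>z. ennreal (kconv K F z)) 0 = econv (epoisson t) (econv ?k ?F) 0"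
    by (rule econv_AE_cong_right) (rule AE)
  also have "\<dots> = econv (econv (epoisson t) ?k) ?F 0"
    by (rule econv_assoc) measurable
  also have "econv (epoisson t) ?k = econv (epoisson t) K"
    by (intro ext econv_AE_cong_right finite_part_AE)
  finally have c: "conv (poisson t) (kconv K F) 0 = enn2real (econv (econv (epoisson t) K) ?F 0)" .
  have "econv (econv (epoisson t) K) ?F 0 \<le> (\<integral>\<^sup>+y. 2 * peak t * ?F y \<partial>lborel)"
    unfolding econv_def[of "econv (epoisson t) K"]
    by (intro nn_integral_mono mult_right_mono econv_poisson_K_le t) auto
  also have "\<dots> = 2 * peak t * ennreal ?W" by (simp add: nn_integral_cmult Fint)
  finally have fin: "econv (econv (epoisson t) K) ?F 0 < \<infinity>"
    using peak_finite[OF t] by (simp add: ennreal_mult_less_top le_less_trans)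
  have "ennreal (?\<kappa> * rpeak t * ?W) = ennreal ?\<kappa> * peak t * ennreal ?W"
    unfolding peak_rpeak[OF t] using t rpeak_pos[OF t]
    by (subst ennreal_mult; (subst ennreal_mult)?; simp)
  also have "\<dots> = (\<integral>\<^sup>+y. ennreal ?\<kappa> * peak t * ?F y \<partial>lborel)"
    by (simp add: nn_integral_cmult Fint)
  also have "\<dots> \<le> econv (econv (epoisson t) K) ?F 0"
    unfolding econv_def[of "econv (epoisson t) K"]
  proof (rule nn_integral_mono)
    fix y
    show "ennreal ?\<kappa> * peak t * ?F y \<le> econv (epoisson t) K (0 - y) * ?F y"
    proof (cases "norm y \<le> t")
      case True
      then show ?thesis
        by (intro mult_right_mono econv_poisson_K_ge t) auto
    qed (simp add: F_def)
  qed
  also have "\<dots> = ennreal (conv (poisson t) (kconv K F) 0)"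
    using fin by (simp add: c)
  finally show "?\<kappa> * rpeak t * ?W \<le> \<bar>conv (poisson t) (kconv K F) 0\<bar>"
    by (subst (asm) ennreal_le_iff) (auto simp: c)
qed

end

section \<open>Openness of sections and superlevel sets\<close>

lemma open_maximal_superlevel:
  assumes "\<And>t. open (cross_section \<Omega> t)"
  shows "open {x. maximal_fun \<Omega> f x > ennreal \<alpha>}"
proof -
  have "{x. maximal_fun \<Omega> f x > ennreal \<alpha>}
      = (\<Union>(y, t)\<in>{(y, t). ennreal \<bar>conv (poisson t) f y\<bar> > ennreal \<alpha>}. (\<lambda>x. y - x) -` cross_section \<Omega> t)"
    (is "?L = ?R")
  proof (intro set_eqI iffI)
    fix x assume "x \<in> ?L"
    then obtain v t where "(v, t) \<in> \<Omega>" "ennreal \<bar>conv (poisson t) f (x + v)\<bar> > ennreal \<alpha>"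
      by (auto simp: maximal_fun_def less_SUP_iff shift_region_def)
    then show "x \<in> ?R"
      by (intro UN_I[of "(x + v, t)"]) (auto simp: cross_section_def)
  next
    fix x assume "x \<in> ?R"
    then obtain y t where yt: "ennreal \<bar>conv (poisson t) f y\<bar> > ennreal \<alpha>" "(y - x, t) \<in> \<Omega>"
      by (auto simp: cross_section_def)
    then have "(y, t) \<in> shift_region x \<Omega>"
      unfolding shift_region_def by (auto intro: exI[of _ "y - x"])
    then show "x \<in> ?L"
      using yt(1) unfolding maximal_fun_def mem_Collect_eq less_SUP_iff by (rule_tac bexI[of _ "(y, t)"]) simp_all
  qed
  also have "open ?R"
    using assms by (auto intro!: open_UN continuous_open_vimage continuous_intros)
  finally show ?thesis .
qed

lemma open_completed_cross_section:
  assumes "\<And>s. open (cross_section \<Omega> s)"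
  shows "open (cross_section (completed_region K \<Omega>) t)"
proof (cases "t > 0")
  case True
  have "cross_section (completed_region K \<Omega>) t
      = (\<Union>s. \<Union>v\<in>{v. norm v \<le> rK K t - rK K s}. (\<lambda>y. y + v) -` cross_section \<Omega> s)"
    (is "?L = ?R")
  proof (intro set_eqI iffI)
    fix y assume "y \<in> ?L"
    then obtain x s where "(x, s) \<in> \<Omega>" "norm (x - y) \<le> rK K t - rK K s"
      by (auto simp: cross_section_def completed_region_def)
    then show "y \<in> ?R"
      by (intro UN_I[of s] UN_I[of "x - y"]) (auto simp: cross_section_def)
  next
    fix y assume "y \<in> ?R"
    then obtain s v where "norm v \<le> rK K t - rK K s" "(y + v, s) \<in> \<Omega>"
      by (auto simp: cross_section_def)
    then show "y \<in> ?L"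
      using True unfolding cross_section_def completed_region_def half_space_def mem_Collect_eq
      by (auto intro: bexI[of _ "(y + v, s)"])
  qed
  also have "open ?R"
    using assms by (auto intro!: open_UN continuous_open_vimage continuous_intros)
  finally show ?thesis .
next
  case False
  then show ?thesis by (simp add: cross_section_def completed_region_def half_space_def)
qed

section \<open>The sparse region and its completion\<close>

context sparse_cones
begin

text \<open>
  The bound holds with the norm of every representing \<open>F\<close>, hence with their infimum.
\<close>
lemma region_weak_type: "weak_type_11 K region"
  unfolding weak_type_11_def
proof (intro exI[of _ weak_const] ballI allI impI)
  fix f and \<alpha> :: real assume f: "f \<in> potential_space K" and \<alpha>: "\<alpha> > 0"
  let ?S = "{x. maximal_fun region f x > ennreal \<alpha>}"
  have openS: "open ?S"
    by (rule open_maximal_superlevel) (rule open_cross_section_region)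
  then have leb: "emeasure lebesgue ?S = emeasure lborel ?S" by simp
  have rep: "emeasure lborel ?S \<le> ennreal (weak_const * (\<integral>x. \<bar>F x\<bar> \<partial>lebesgue) / \<alpha>)"
    if F: "represents K F f" for F
  proof -
    obtain G where G: "G \<in> borel_measurable borel" "(\<integral>\<^sup>+x. G x \<partial>lborel) = ennreal (\<integral>x. \<bar>F x\<bar> \<partial>lebesgue)"
      "AE z in lebesgue. ennreal \<bar>f z\<bar> \<le> econv K G z"
      by (rule represents_dominated[OF F])
    show ?thesis
    proof (rule region_superlevel_measure[OF G(1) \<alpha> G(2)])
      fix x assume "x \<in> ?S"
      then obtain y s where ys: "(y, s) \<in> shift_region x region"
        "ennreal \<bar>conv (poisson s) f y\<bar> > ennreal \<alpha>"
        by (auto simp: maximal_fun_def less_SUP_iff)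
      then have "s > 0" using region_subset by (auto simp: shift_region_def half_space_def)
      then have "ennreal \<bar>conv (poisson s) f y\<bar> \<le> econv (epoisson s) (econv K G) y"
        by (intro abs_conv_le_econv G(3) poisson_nonneg)
      then show "\<exists>(y, s)\<in>shift_region x region. econv (epoisson s) (econv K G) y > ennreal \<alpha>"
        using ys by (intro bexI[of _ "(y, s)"]) auto
    qed simp
  qed
  obtain F0 where F0: "represents K F0 f" using f by (auto simp: potential_space_def)
  have "emeasure lborel ?S < \<infinity>"
    using rep[OF F0] by (rule le_less_trans) simp
  then obtain m where m: "emeasure lborel ?S = ennreal m" "m \<ge> 0"
    by (cases "emeasure lborel ?S") auto
  have "m \<le> weak_const * potential_norm K f / \<alpha>"
  proof (cases "weak_const = 0")
    case True
    then show ?thesis using rep[OF F0] m by simp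
  next
    case False
    then have w: "weak_const > 0" using weak_const_nonneg by simp
    have "m * \<alpha> / weak_const \<le> potential_norm K f"
      unfolding potential_norm_def
    proof (rule cInf_greatest)
      show "{\<integral>x. \<bar>F x\<bar> \<partial>lebesgue | F. represents K F f} \<noteq> {}" using F0 by blast
    next
      fix r assume "r \<in> {\<integral>x. \<bar>F x\<bar> \<partial>lebesgue | F. represents K F f}"
      then obtain F where F: "represents K F f" "r = (\<integral>x. \<bar>F x\<bar> \<partial>lebesgue)" by blast
      have "r \<ge> 0" unfolding F(2) by simp
      then have "m \<le> weak_const * r / \<alpha>"
        using rep[OF F(1)] w \<alpha> unfolding m(1) F(2)[symmetric] by (subst (asm) ennreal_le_iff) auto
      then show "m * \<alpha> / weak_const \<le> r" using w \<alpha> by (simp add: field_simps)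
    qed
    then show ?thesis using w \<alpha> by (simp add: field_simps)
  qed
  then show "emeasure lebesgue ?S \<le> ennreal (weak_const * potential_norm K f / \<alpha>)"
    unfolding leb m(1) by (rule ennreal_leI)
qed

abbreviation completed :: "((real ^ 'n) \<times> real) set" where
  "completed \<equiv> completed_region K region"

lemma open_cross_section_completed: "open (cross_section completed t)"
  by (rule open_completed_cross_section) (rule open_cross_section_region)

text \<open>
  Over each vertex of the \<open>k\<close>-th group the completed region contains, at height \<open>T k\<close>, a ball of
  radius \<open>r\<^sub>K(T k) / 2\<close>, and the vertices are so far apart that these balls are disjoint.
\<close>
lemma emeasure_cross_section_completed:
  "ennreal (real k * (unit_ball_vol (real CARD('n)) * (rK K (T k) / 2) ^ CARD('n)))
     \<le> emeasure lborel (cross_section completed (T k))"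
proof -
  let ?r = "rK K (T k) / 2"
  have r: "?r > 0" using rK_pos[OF T_pos] by simp
  have sub: "(\<Union>i\<in>{..<k}. ball (vertex k i) ?r) \<subseteq> cross_section completed (T k)"
  proof clarify
    fix i y assume i: "i < k" and y: "y \<in> ball (vertex k i) ?r"
    have "(vertex k i, 2 * \<tau> k) \<in> region"
  proof -
      have "norm (vertex k i - vertex k i) < 2 * \<tau> k - \<tau> k" using \<tau>_pos[of k] by simp
      then show ?thesis using i unfolding region_def mem_Collect_eq case_prod_conv by blast
    qed
    moreover have "norm (vertex k i - y) \<le> rK K (T k) - rK K (2 * \<tau> k)"
      using y deep[of k] by (simp add: dist_norm)
    ultimately show "y \<in> cross_section completed (T k)"
      using T_pos[of k] by (auto simp: cross_section_def completed_region_def half_space_def)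
  qed
  have "disjoint_family_on (\<lambda>i. ball (vertex k i) ?r) {..<k}"
    unfolding disjoint_family_on_def
  proof (intro ballI impI)
    fix i j :: nat assume "i \<noteq> j"
    then have "rK K (T k) \<le> dist (vertex k i) (vertex k j)"
      using vertex_separated[of i j k] separated[of k] by (simp add: dist_norm)
    then show "ball (vertex k i) ?r \<inter> ball (vertex k j) ?r = {}"
      by (intro disjoint_ballI) simp
  qed
  then have "emeasure lborel (\<Union>i\<in>{..<k}. ball (vertex k i) ?r)
      = (\<Sum>i\<in>{..<k}. emeasure lborel (ball (vertex k i) ?r))"
    by (intro sum_emeasure[symmetric]) auto
  also have "\<dots> = ennreal (real k * (unit_ball_vol (real CARD('n)) * ?r ^ CARD('n)))"
    using r by (simp add: emeasure_ball ennreal_of_nat_eq_real_of_nat ennreal_mult)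
  finally have "ennreal (real k * (unit_ball_vol (real CARD('n)) * ?r ^ CARD('n)))
      = emeasure lborel (\<Union>i\<in>{..<k}. ball (vertex k i) ?r)" ..
  also have "\<dots> \<le> emeasure lborel (cross_section completed (T k))"
    using open_cross_section_completed[of "T k"] by (intro emeasure_mono sub) auto
  finally show ?thesis .
qed

lemma completed_volume_unbounded:
  "\<not> (\<exists>C::real. \<forall>t>0. emeasure lebesgue (cross_section completed t) / ennreal (rK K t ^ CARD('n))
        \<le> ennreal C)"
proof
  assume "\<exists>C::real. \<forall>t>0. emeasure lebesgue (cross_section completed t) / ennreal (rK K t ^ CARD('n))
        \<le> ennreal C"
  then obtain C where C: "\<And>t. t > 0 \<Longrightarrow>
      emeasure lebesgue (cross_section completed t) / ennreal (rK K t ^ CARD('n)) \<le> ennreal C" by blast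
  let ?v = "unit_ball_vol (real CARD('n)) / 2 ^ CARD('n)"
  have v: "?v > 0" by (intro divide_pos_pos) auto
  obtain k where k: "max C 0 / ?v < real k" using reals_Archimedean2 by blast
  define R where "R = rK K (T k) ^ CARD('n)"
  have R: "R > 0" unfolding R_def using rK_pos[OF T_pos] by (rule zero_less_power)
  have "ennreal (real k * ?v) = ennreal (real k * ?v * R) / ennreal R"
    using R v by (subst divide_ennreal) auto
  also have "real k * ?v * R = real k * (unit_ball_vol (real CARD('n)) * (rK K (T k) / 2) ^ CARD('n))"
    by (simp add: power_divide R_def)
  also have "ennreal \<dots> / ennreal R \<le> emeasure lborel (cross_section completed (T k)) / ennreal R"
    by (intro divide_right_mono_ennreal emeasure_cross_section_completed)
  also have "\<dots> \<le> ennreal C"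
    using C[OF T_pos] open_cross_section_completed by (simp add: R_def)
  also have "\<dots> \<le> ennreal (max C 0)" by (rule ennreal_leI) simp
  finally have "real k * ?v \<le> max C 0" by (subst (asm) ennreal_le_iff) auto
  then show False using k v by (simp add: field_simps)
qed

text \<open>
  For the potential of the ball of radius \<open>T k\<close> the reflected section at height \<open>T k\<close> lies in a
  superlevel set: over a point \<open>x\<close> of it, the region translated by \<open>x\<close> contains the point \<open>(0, T k)\<close>.
  The volume of the ball cancels, and the factor \<open>k\<close> in the volume of the section remains.
\<close>
lemma completed_not_weak_type: "\<not> weak_type_11 K completed"
proof
  assume "weak_type_11 K completed"
  then obtain C where C: "\<And>f \<alpha>. f \<in> potential_space K \<Longrightarrow> \<alpha> > 0 \<Longrightarrow>
      emeasure lebesgue {x. maximal_fun completed f x > ennreal \<alpha>} \<le> ennreal (C * potential_norm K f / \<alpha>)"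
    unfolding weak_type_11_def by blast
  let ?V = "unit_ball_vol (real CARD('n))"
  let ?\<kappa> = "(1/3) ^ (CARD('n) + 1) :: real"
  have V: "?V > 0" by simp
  obtain k where k: "4 * 2 ^ CARD('n) * \<bar>C\<bar> / (?\<kappa> * ?V) < real k" using reals_Archimedean2 by blast
  define t where "t = T k"
  have t: "t > 0" by (simp add: t_def T_pos)
  let ?W = "?V * t ^ CARD('n)"
  have W: "?W > 0" using t V by (intro mult_pos_pos) auto
  define F where "F = (indicator (cball 0 t) :: real ^ 'n \<Rightarrow> real)"
  define f where "f = kconv K F"
  note test = ball_potential[OF t, folded F_def, folded f_def]
  define \<alpha> where "\<alpha> = ?\<kappa> * rpeak t * ?W / 2"
  have \<alpha>: "\<alpha> > 0" using rpeak_pos[OF t] W by (simp add: \<alpha>_def)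
  have f: "f \<in> potential_space K" using test(1) by (auto simp: potential_space_def)
  let ?A = "cross_section completed t" and ?S = "{x. maximal_fun completed f x > ennreal \<alpha>}"
  have A: "open ?A" by (rule open_cross_section_completed)
  have S: "open ?S" by (rule open_maximal_superlevel) (rule open_cross_section_completed)
  have sub: "{x. 0 - x \<in> ?A} \<subseteq> ?S"
  proof
    fix x assume "x \<in> {x. 0 - x \<in> ?A}"
    then have "(0, t) \<in> shift_region x completed"
      unfolding shift_region_def cross_section_def by (auto intro!: exI[of _ "- x"])
    moreover have "ennreal \<bar>conv (poisson t) f 0\<bar> > ennreal \<alpha>"
      using test(3) \<alpha> by (intro ennreal_lessI) (auto simp: \<alpha>_def)
    ultimately show "x \<in> ?S"
      unfolding maximal_fun_def mem_Collect_eq less_SUP_iff by (intro bexI[of _ "(0, t)"]) simp_all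
  qed
  have [measurable]: "?A \<in> sets borel" using A by simp
  have reflA: "{x. 0 - x \<in> ?A} \<in> sets borel" by measurable
  have "emeasure lborel ?A = (\<integral>\<^sup>+x. indicator ?A (0 - x) \<partial>lborel)"
    by (subst nn_integral_lborel_reflect) auto
  also have "\<dots> = (\<integral>\<^sup>+x. indicator {x. 0 - x \<in> ?A} x \<partial>lborel)"
    by (rule nn_integral_cong) (simp add: indicator_def)
  also have "\<dots> = emeasure lborel {x. 0 - x \<in> ?A}" using reflA by simp
  also have "\<dots> \<le> emeasure lborel ?S" using S sub by (intro emeasure_mono) auto
  also have "\<dots> \<le> ennreal (C * potential_norm K f / \<alpha>)" using C[OF f \<alpha>] S by simp
  also have "\<dots> \<le> ennreal (\<bar>C\<bar> * ?W / \<alpha>)"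
  proof (intro ennreal_leI divide_right_mono)
    have "C * potential_norm K f \<le> \<bar>C\<bar> * potential_norm K f"
      using potential_norm_nonneg[OF f] by (intro mult_right_mono) auto
    also have "\<dots> \<le> \<bar>C\<bar> * ?W"
      using potential_norm_le[OF test(1)] test(2) by (intro mult_left_mono) auto
    finally show "C * potential_norm K f \<le> \<bar>C\<bar> * ?W" .
  qed (use \<alpha> in simp)
  finally have "ennreal (real k * (?V * (rK K t / 2) ^ CARD('n))) \<le> ennreal (\<bar>C\<bar> * ?W / \<alpha>)"
    using emeasure_cross_section_completed[of k] unfolding t_def by (rule order_trans[rotated])
  then have le: "real k * (?V * (rK K t / 2) ^ CARD('n)) \<le> \<bar>C\<bar> * ?W / \<alpha>"
    using W \<alpha> by (subst (asm) ennreal_le_iff) auto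
  have "real k * ?V / 2 ^ CARD('n) * (1 / (2 * rpeak t)) \<le> real k * ?V / 2 ^ CARD('n) * rK K t ^ CARD('n)"
    by (intro mult_left_mono rK_power_bounds t) auto
  also have "\<dots> = real k * (?V * (rK K t / 2) ^ CARD('n))" by (simp add: power_divide)
  also note le
  also have "\<bar>C\<bar> * ?W / \<alpha> = 2 * \<bar>C\<bar> / (?\<kappa> * rpeak t)"
  proof -
    have "\<bar>C\<bar> * w / (\<kappa> * a * w / 2) = 2 * \<bar>C\<bar> / (\<kappa> * a)" if "w > 0" for w \<kappa> a :: real
      using that by (simp add: field_simps)
    from this[OF W] show ?thesis by (simp only: \<alpha>_def)
  qed
  finally have bound: "real k * ?V / 2 ^ CARD('n) * (1 / (2 * rpeak t)) \<le> 2 * \<bar>C\<bar> / (?\<kappa> * rpeak t)" .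
  have solve: "real k \<le> 4 * N * c / (\<kappa> * V)"
    if "real k * V / N * (1 / (2 * a)) \<le> 2 * c / (\<kappa> * a)" "V > 0" "N > 0" "a > 0" "\<kappa> > 0" for V N a c \<kappa> :: real
    using that by (simp add: field_simps)
  have "real k \<le> 4 * 2 ^ CARD('n) * \<bar>C\<bar> / (?\<kappa> * ?V)"
    by (rule solve[OF bound V _ rpeak_pos[OF t]]) simp_all
  then show False using k by simp
qed

end

theorem theorem2p1:
  fixes K :: "real ^ 'n::finite \<Rightarrow> ennreal"
  assumes K_measurable: "K \<in> borel_measurable lebesgue"
    and K_integrable: "(\<integral>\<^sup>+ x. K x \<partial>lebesgue) < \<infinity>"
    and K_radial: "\<And>x y. norm x = norm y \<Longrightarrow> K x = K y"
    and K_decreasing: "\<And>x y. norm x \<le> norm y \<Longrightarrow> K x \<ge> K y"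
    and K_zero: "K 0 = \<infinity>"
    and K_unbounded: "(K \<longlongrightarrow> \<infinity>) (at 0)"
  shows "\<exists>\<Omega> :: ((real ^ 'n) \<times> real) set.
      \<Omega> \<subseteq> half_space
    \<and> cone_condition \<Omega>
    \<and> (\<forall>t>0. cross_section \<Omega> t \<in> sets lebesgue)
    \<and> (\<exists>C::real. \<forall>t>0. emeasure lebesgue (cross_section \<Omega> t) \<le> ennreal (C * rK K t ^ CARD('n)))
    \<and> weak_type_11 K \<Omega>
    \<and> \<not> (\<exists>C::real. \<forall>t>0.
          emeasure lebesgue (cross_section (completed_region K \<Omega>) t) / ennreal (rK K t ^ CARD('n))
            \<le> ennreal C)
    \<and> \<not> weak_type_11 K (completed_region K \<Omega>)"
proof -
  interpret radial_kernel K
    using K_integrable K_decreasing K_unbounded by unfold_locales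
  obtain \<delta> \<tau> T where "sparse_cones K \<delta> \<tau> T" using parameters_exist by blast
  then interpret sparse_cones K \<delta> \<tau> T .
  have leb: "cross_section region t \<in> sets lebesgue"
    "emeasure lebesgue (cross_section region t) = emeasure lborel (cross_section region t)" for t
    using open_cross_section_region[of t] by simp_all
  show ?thesis
    using region_subset region_cone leb emeasure_cross_section_region region_weak_type
      completed_volume_unbounded completed_not_weak_type
    by (intro exI[of _ region]) auto
qed

end
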